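(* There is a complete (regular) subalgebra of the Cohen algebra $\mathbb C(\aleph_2)$ which has uniform density $\aleph_2$ but is not isomorphic to $\mathbb C(\aleph_2)$.
   Context: For a set $I$ of ordinals, $C(I)$ is the poset of finite partial functions from $I$ to $\{0,1\}$ ordered by reverse extension and $\mathbb C(I)=RO(C(I))$ its regular open algebra. A subalgebra $A$ of a complete Boolean algebra $B$ is complete (regular) if every maximal antichain of $A$ is maximal in $B$. A complete Boolean algebra $B$ has uniform density $\kappa$ if for every nonzero $b\in B$ the least cardinality of a dense subset of $\{c\in B:0<c\le b\}$ is $\kappa$. *)

theory Defs
  imports Main
begin

definition aleph2 :: "nat set set rel" where
  "aleph2 = cardSuc (cardSuc natLeq)"

text \<open>The Cohen poset C(I): finite partial functions from I to {0,1} (here bool).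
  The order is reverse extension: q is stronger than p iff q extends p.\<close>
definition cohen_poset :: "'a set \<Rightarrow> ('a \<rightharpoonup> bool) set" where
  "cohen_poset I = {p. finite (dom p) \<and> dom p \<subseteq> I}"

text \<open>Regular open subsets of C(I) (w.r.t. the topology of downward closed sets):
  U = int(cl U).\<close>
definition regular_open :: "'a set \<Rightarrow> ('a \<rightharpoonup> bool) set \<Rightarrow> bool" where
  "regular_open I U \<longleftrightarrow> U \<subseteq> cohen_poset I \<and>
     (\<forall>p\<in>cohen_poset I. p \<in> U \<longleftrightarrow>
        (\<forall>q\<in>cohen_poset I. p \<subseteq>\<^sub>m q \<longrightarrow> (\<exists>r\<in>U. q \<subseteq>\<^sub>m r)))"

text \<open>The Cohen algebra RO(C(I)), ordered by inclusion; zero is {}, one is C(I).\<close>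
definition cohen_algebra :: "'a set \<Rightarrow> ('a \<rightharpoonup> bool) set set" where
  "cohen_algebra I = {U. regular_open I U}"

definition ro_compl :: "'a set \<Rightarrow> ('a \<rightharpoonup> bool) set \<Rightarrow> ('a \<rightharpoonup> bool) set" where
  "ro_compl I U = {p\<in>cohen_poset I. \<forall>q\<in>cohen_poset I. p \<subseteq>\<^sub>m q \<longrightarrow> q \<notin> U}"

text \<open>Supremum in RO(C(I)) of a family S: int(cl(\<Union>S)).\<close>
definition ro_sup :: "'a set \<Rightarrow> ('a \<rightharpoonup> bool) set set \<Rightarrow> ('a \<rightharpoonup> bool) set" where
  "ro_sup I S = {p\<in>cohen_poset I. \<forall>q\<in>cohen_poset I. p \<subseteq>\<^sub>m q \<longrightarrow> (\<exists>r\<in>\<Union>S. q \<subseteq>\<^sub>m r)}"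

text \<open>Boolean subalgebra of RO(C(I)) (meets in RO(C(I)) are intersections).\<close>
definition ro_subalgebra :: "'a set \<Rightarrow> ('a \<rightharpoonup> bool) set set \<Rightarrow> bool" where
  "ro_subalgebra I A \<longleftrightarrow> A \<subseteq> cohen_algebra I \<and> {} \<in> A \<and> cohen_poset I \<in> A \<and>
     (\<forall>U\<in>A. \<forall>V\<in>A. U \<inter> V \<in> A) \<and> (\<forall>U\<in>A. ro_compl I U \<in> A)"

definition maximal_antichain :: "'x set set \<Rightarrow> 'x set set \<Rightarrow> bool" where
  "maximal_antichain A W \<longleftrightarrow> W \<subseteq> A \<and> {} \<notin> W \<and>
     (\<forall>U\<in>W. \<forall>V\<in>W. U \<noteq> V \<longrightarrow> U \<inter> V = {}) \<and>
     (\<forall>U\<in>A. U \<noteq> {} \<longrightarrow> (\<exists>V\<in>W. U \<inter> V \<noteq> {}))"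

definition complete_subalgebra :: "'a set \<Rightarrow> ('a \<rightharpoonup> bool) set set \<Rightarrow> bool" where
  "complete_subalgebra I A \<longleftrightarrow> ro_subalgebra I A \<and>
     (\<forall>S. S \<subseteq> A \<longrightarrow> ro_sup I S \<in> A) \<and>
     (\<forall>W. maximal_antichain A W \<longrightarrow> maximal_antichain (cohen_algebra I) W)"

definition dense_below :: "'x set set \<Rightarrow> 'x set \<Rightarrow> 'x set set \<Rightarrow> bool" where
  "dense_below A b D \<longleftrightarrow> D \<subseteq> {c\<in>A. c \<noteq> {} \<and> c \<subseteq> b} \<and>
     (\<forall>c\<in>A. c \<noteq> {} \<and> c \<subseteq> b \<longrightarrow> (\<exists>d\<in>D. d \<subseteq> c))"

definition uniform_density :: "'x set set \<Rightarrow> 'k rel \<Rightarrow> bool" where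
  "uniform_density A \<kappa> \<longleftrightarrow> (\<forall>b\<in>A. b \<noteq> {} \<longrightarrow>
     (\<exists>D. dense_below A b D \<and> ordIso2 (card_of D) \<kappa>) \<and>
     (\<forall>D. dense_below A b D \<longrightarrow> ordLeq2 \<kappa> (card_of D)))"

text \<open>Boolean algebra isomorphism = order isomorphism w.r.t. inclusion.\<close>
definition ba_isomorphic :: "'x set set \<Rightarrow> 'y set set \<Rightarrow> bool" where
  "ba_isomorphic A B \<longleftrightarrow> (\<exists>f. bij_betw f A B \<and> (\<forall>U\<in>A. \<forall>V\<in>A. U \<subseteq> V \<longleftrightarrow> f U \<subseteq> f V))"

end

theory Submission
  imports Defs "HOL-Library.Countable_Set_Type"
begin

text \<open>Let \<open>z \<subseteq> \<omega>\<close> be a Cohen real and add, generically over \<open>z\<close>, reals \<open>x\<^sub>j \<subseteq> \<omega>\<close> for \<open>\<aleph>\<^sub>2\<close> many indices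
  \<open>j\<close> of two kinds: those of the first kind are almost contained in \<open>z\<close>, those of the second kind
  almost disjoint from \<open>z\<close>.  The algebra generated by the \<open>x\<^sub>j\<close>, with \<open>z\<close> hidden, is a regular subalgebra
  of the Cohen algebra.  Any two reals \<open>x\<^sub>a\<close>, \<open>x\<^sub>b\<close> of different kinds are almost disjoint, but from which
  point on cannot be decided by information about the reals other than \<open>x\<^sub>b\<close> together with information
  about the reals other than \<open>x\<^sub>a\<close>.  In a Cohen algebra such separate information would suffice:
  each \<open>x\<^sub>j\<close> would depend on countably many Cohen coordinates, each coordinate on
  countably many reals, and the resulting set mapping on \<open>\<aleph>\<^sub>2\<close> has a free pair \<open>a\<close>, \<open>b\<close>.\<close>

section \<open>Regular open sets of finite partial functions\<close>

lemma cohen_poset_add: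
  "p \<in> cohen_poset I \<Longrightarrow> q \<in> cohen_poset I \<Longrightarrow> p ++ q \<in> cohen_poset I"
  unfolding cohen_poset_def by auto

lemma cohen_poset_restrict: "p \<in> cohen_poset I \<Longrightarrow> p |` J \<in> cohen_poset I"
  unfolding cohen_poset_def by auto

lemma restrict_map_le: "p |` J \<subseteq>\<^sub>m p"
  by (simp add: map_le_def)

lemma regular_openD: "regular_open I U \<Longrightarrow> U \<subseteq> cohen_poset I"
  by (simp add: regular_open_def)

lemma regular_open_up:
  assumes "regular_open I U" "p \<in> U" "p \<subseteq>\<^sub>m q" "q \<in> cohen_poset I"
  shows "q \<in> U"
  using assms unfolding regular_open_def by (meson map_le_trans subsetD)

lemma regular_openI_dense:
  assumes "regular_open I U" "p \<in> cohen_poset I"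
    and "\<And>q. q \<in> cohen_poset I \<Longrightarrow> p \<subseteq>\<^sub>m q \<Longrightarrow> \<exists>r\<in>U. q \<subseteq>\<^sub>m r"
  shows "p \<in> U"
  using assms unfolding regular_open_def by blast

lemma regular_open_avoid:
  assumes "regular_open I U" "p \<in> cohen_poset I" "p \<notin> U"
  obtains q where "q \<in> cohen_poset I" "p \<subseteq>\<^sub>m q" "\<And>r. r \<in> U \<Longrightarrow> \<not> q \<subseteq>\<^sub>m r"
  using regular_openI_dense[OF assms(1,2)] assms(3) by blast

section \<open>Suprema, meets and complements of regular open sets\<close>

lemma ro_sup_regular_open:
  assumes "\<Union>S \<subseteq> cohen_poset I"
  shows "regular_open I (ro_sup I S)"
proof -
  have *: "\<exists>r\<in>\<Union>S. q \<subseteq>\<^sub>m r"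
    if asm: "p \<in> cohen_poset I" "\<forall>q\<in>cohen_poset I. p \<subseteq>\<^sub>m q \<longrightarrow> (\<exists>r\<in>ro_sup I S. q \<subseteq>\<^sub>m r)"
      "q \<in> cohen_poset I" "p \<subseteq>\<^sub>m q" for p q
  proof -
    obtain r where r: "r \<in> ro_sup I S" "q \<subseteq>\<^sub>m r" using asm by blast
    then obtain s where "s \<in> \<Union>S" "r \<subseteq>\<^sub>m s" unfolding ro_sup_def using map_le_refl by blast
    then show ?thesis using r by (meson map_le_trans)
  qed
  have "q \<in> ro_sup I S" if "p \<in> ro_sup I S" "q \<in> cohen_poset I" "p \<subseteq>\<^sub>m q" for p q
    using that unfolding ro_sup_def by (simp, meson map_le_trans)
  then have "\<forall>p\<in>cohen_poset I. p \<in> ro_sup I S \<longrightarrow>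
      (\<forall>q\<in>cohen_poset I. p \<subseteq>\<^sub>m q \<longrightarrow> (\<exists>r\<in>ro_sup I S. q \<subseteq>\<^sub>m r))"
    by (meson map_le_refl)
  moreover have "ro_sup I S \<subseteq> cohen_poset I" by (auto simp: ro_sup_def)
  moreover have "p \<in> ro_sup I S"
    if "p \<in> cohen_poset I" "\<forall>q\<in>cohen_poset I. p \<subseteq>\<^sub>m q \<longrightarrow> (\<exists>r\<in>ro_sup I S. q \<subseteq>\<^sub>m r)" for p
    using *[OF that] that(1) unfolding ro_sup_def by blast
  ultimately show ?thesis unfolding regular_open_def by blast
qed

lemma ro_sup_upper:
  assumes "U \<in> S" "regular_open I U"
  shows "U \<subseteq> ro_sup I S"
proof
  fix p assume p: "p \<in> U"
  then have "q \<in> U" if "q \<in> cohen_poset I" "p \<subseteq>\<^sub>m q" for q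
    using regular_open_up[OF assms(2)] that by blast
  then show "p \<in> ro_sup I S"
    using p assms regular_openD[OF assms(2)] map_le_refl unfolding ro_sup_def by blast
qed

lemma regular_open_Inter:
  assumes "\<And>U. U \<in> S \<Longrightarrow> regular_open I U" "S \<noteq> {}"
  shows "regular_open I (\<Inter>S)"
proof -
  obtain U where U: "U \<in> S" using assms(2) by blast
  have sub: "\<Inter>S \<subseteq> cohen_poset I" using U assms(1) regular_openD by blast
  have up: "q \<in> \<Inter>S" if "p \<in> \<Inter>S" "p \<subseteq>\<^sub>m q" "q \<in> cohen_poset I" for p q
    using that assms(1) regular_open_up by (metis InterD InterI)
  show ?thesis
    unfolding regular_open_def
  proof (intro conjI ballI iffI impI sub)
    fix p q assume "p \<in> \<Inter>S" "p \<subseteq>\<^sub>m q" "q \<in> cohen_poset I"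
    then show "\<exists>r\<in>\<Inter>S. q \<subseteq>\<^sub>m r" using up map_le_refl by blast
  next
    fix p assume p: "p \<in> cohen_poset I"
      and d: "\<forall>q\<in>cohen_poset I. p \<subseteq>\<^sub>m q \<longrightarrow> (\<exists>r\<in>\<Inter>S. q \<subseteq>\<^sub>m r)"
    show "p \<in> \<Inter>S"
    proof
      fix V assume V: "V \<in> S"
      show "p \<in> V"
        by (rule regular_openI_dense[OF assms(1)[OF V] p]) (use d V in blast)
    qed
  qed
qed

lemma regular_open_Int:
  "regular_open I U \<Longrightarrow> regular_open I V \<Longrightarrow> regular_open I (U \<inter> V)"
  using regular_open_Inter[of "{U, V}" I] by auto

lemma regular_open_compl:
  assumes "regular_open I U"
  shows "regular_open I (ro_compl I U)"
proof -
  have up: "q \<in> ro_compl I U" if "p \<in> ro_compl I U" "p \<subseteq>\<^sub>m q" "q \<in> cohen_poset I" for p q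
    using that unfolding ro_compl_def by (simp, meson map_le_trans)
  show ?thesis
    unfolding regular_open_def
  proof (intro conjI ballI iffI impI)
    show "ro_compl I U \<subseteq> cohen_poset I" by (auto simp: ro_compl_def)
  next
    fix p q assume "p \<in> ro_compl I U" "p \<subseteq>\<^sub>m q" "q \<in> cohen_poset I"
    then show "\<exists>r\<in>ro_compl I U. q \<subseteq>\<^sub>m r" using up map_le_refl by blast
  next
    fix p assume p: "p \<in> cohen_poset I"
      and d: "\<forall>q\<in>cohen_poset I. p \<subseteq>\<^sub>m q \<longrightarrow> (\<exists>r\<in>ro_compl I U. q \<subseteq>\<^sub>m r)"
    have "q \<notin> U" if q: "q \<in> cohen_poset I" "p \<subseteq>\<^sub>m q" for q
    proof
      assume "q \<in> U"
      obtain r where "r \<in> ro_compl I U" "q \<subseteq>\<^sub>m r" using d q by blast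
      then show False
        using \<open>q \<in> U\<close> regular_open_up[OF assms] unfolding ro_compl_def by fastforce
    qed
    then show "p \<in> ro_compl I U" using p unfolding ro_compl_def by blast
  qed
qed

lemma regular_open_empty: "regular_open I {}"
  unfolding regular_open_def using map_le_refl by blast

lemma regular_open_full: "regular_open I (cohen_poset I)"
  unfolding regular_open_def using map_le_refl by blast

section \<open>Basic open sets and separativity of the Cohen poset\<close>

definition basic_open :: "'a set \<Rightarrow> ('a \<rightharpoonup> bool) \<Rightarrow> ('a \<rightharpoonup> bool) set" where
  "basic_open I p = {q \<in> cohen_poset I. p \<subseteq>\<^sub>m q}"

lemma map_le_addI: 
  assumes "\<And>x a b. p x = Some a \<Longrightarrow> q x = Some b \<Longrightarrow> a = b"
  shows "p \<subseteq>\<^sub>m p ++ q"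
  unfolding map_le_def
proof
  fix x assume "x \<in> dom p"
  then show "p x = (p ++ q) x"
    by (cases "q x") (auto simp: map_add_def dest: assms)
qed

lemma regular_open_basic_open:
  assumes "p \<in> cohen_poset I"
  shows "regular_open I (basic_open I p)"
proof -
  have "q \<in> basic_open I p"
    if q: "q \<in> cohen_poset I" 
      and d: "\<And>q'. q' \<in> cohen_poset I \<Longrightarrow> q \<subseteq>\<^sub>m q' \<Longrightarrow> \<exists>r\<in>basic_open I p. q' \<subseteq>\<^sub>m r" for q
  proof (rule ccontr)
    assume "q \<notin> basic_open I p"
    then have "\<not> p \<subseteq>\<^sub>m q" using q by (simp add: basic_open_def)
    then obtain x b where x: "p x = Some b" "q x \<noteq> Some b"
      unfolding map_le_def by auto
    have xI: "x \<in> I" using x assms unfolding cohen_poset_def by auto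
    \<comment> \<open>Separativity: either \<open>q\<close> already disagrees with \<open>p\<close>
      at \<open>x\<close>, or it is undefined there and receives the opposite bit. No common
      extension with \<open>p\<close> remains.\<close>
    have 1: "q \<subseteq>\<^sub>m [x \<mapsto> \<not> b] ++ q" by simp
    have 2: "[x \<mapsto> \<not> b] ++ q \<in> cohen_poset I"
      using xI q by (intro cohen_poset_add) (auto simp: cohen_poset_def)
    obtain r where r: "p \<subseteq>\<^sub>m r" "[x \<mapsto> \<not> b] ++ q \<subseteq>\<^sub>m r"
      using d[OF 2 1] unfolding basic_open_def by auto
    have "([x \<mapsto> \<not> b] ++ q) x = Some (\<not> b)" using x
      by (cases "q x") (auto simp: map_add_def)
    then have "r x = Some (\<not> b)" using r(2) by (metis domI map_le_def)
    moreover have "r x = Some b" using r(1) x(1) by (metis domI map_le_def)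
    ultimately show False by simp
  qed
  moreover have "\<exists>r\<in>basic_open I p. q' \<subseteq>\<^sub>m r"
    if "q \<in> basic_open I p" "q' \<in> cohen_poset I" "q \<subseteq>\<^sub>m q'" for q q'
    using that map_le_trans[of p q q'] map_le_refl[of q'] unfolding basic_open_def by blast
  moreover have "basic_open I p \<subseteq> cohen_poset I" by (auto simp: basic_open_def)
  ultimately show ?thesis unfolding regular_open_def by blast
qed

section \<open>Countable supports\<close>

text \<open>Counting measure: of all total assignments on the finite union \<open>X\<close> of the
  domains, coded as subsets of \<open>X\<close>, each \<open>p\<close> is extended by the fraction
  \<open>1 / 2 ^ n\<close>, and incompatible conditions have no common total extension.\<close>

lemma finite_antichain_card:
  fixes P :: "('a \<rightharpoonup> bool) set"
  assumes "finite P" and P: "\<And>p. p \<in> P \<Longrightarrow> finite (dom p) \<and> card (dom p) = n"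
    and anti: "\<And>p q. p \<in> P \<Longrightarrow> q \<in> P \<Longrightarrow> p \<noteq> q \<Longrightarrow> \<exists>x a b. p x = Some a \<and> q x = Some b \<and> a \<noteq> b"
  shows "card P \<le> 2 ^ n"
proof (cases "P = {}")
  case False
  define X where "X = (\<Union>p\<in>P. dom p)"
  have fX: "finite X" unfolding X_def using assms(1) P by auto
  define T where "T p = {Y. Y \<subseteq> X \<and> (\<forall>x\<in>dom p. p x = Some (x \<in> Y))}" for p
  have "T p = (\<lambda>Z. Z \<union> {x. p x = Some True}) ` Pow (X - dom p)" if "p \<in> P" for p
  proof -
    have sub: "dom p \<subseteq> X" unfolding X_def using that by auto
    have "Y \<in> (\<lambda>Z. Z \<union> {x. p x = Some True}) ` Pow (X - dom p)" if "Y \<in> T p" for Y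
    proof -
      have "Y = (Y - dom p) \<union> {x. p x = Some True}" using that unfolding T_def by force
      moreover have "Y - dom p \<in> Pow (X - dom p)" using that unfolding T_def by auto
      ultimately show ?thesis by (rule image_eqI)
    qed
    moreover have "Z \<union> {x. p x = Some True} \<in> T p" if "Z \<subseteq> X - dom p" for Z
      using that sub unfolding T_def by auto
    ultimately show ?thesis by auto
  qed
  moreover have "inj_on (\<lambda>Z. Z \<union> {x. p x = Some True}) (Pow (X - dom p))" for p :: "'a \<rightharpoonup> bool"
    by (rule inj_onI) (auto simp: set_eq_iff, (metis domI Diff_iff subsetD)+)
  ultimately have cT: "card (T p) = 2 ^ (card X - n)" if "p \<in> P" for p
    using P[OF that] that fX unfolding X_def
    by (auto simp: card_image card_Pow card_Diff_subset SUP_upper)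
  have "n \<le> card X" using False P fX card_mono unfolding X_def
    by (metis SUP_upper ex_in_conv)
  have "card P * 2 ^ (card X - n) = (\<Sum>p\<in>P. card (T p))" using cT by simp
  also have "\<dots> = card (\<Union>p\<in>P. T p)"
  proof (rule card_UN_disjoint[symmetric, OF assms(1)])
    show "\<forall>i\<in>P. finite (T i)" using fX unfolding T_def by auto
    show "\<forall>i\<in>P. \<forall>j\<in>P. i \<noteq> j \<longrightarrow> T i \<inter> T j = {}"
    proof (intro ballI impI)
      fix p q assume "p \<in> P" "q \<in> P" "p \<noteq> q"
      then obtain x a b where "p x = Some a" "q x = Some b" "a \<noteq> b" using anti by blast
      then show "T p \<inter> T q = {}" unfolding T_def by force
    qed
  qed
  also have "\<dots> \<le> card (Pow X)" using fX by (intro card_mono) (auto simp: T_def)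
  also have "\<dots> = 2 ^ n * 2 ^ (card X - n)"
    using fX \<open>n \<le> card X\<close> by (simp add: card_Pow flip: power_add)
  finally show ?thesis by simp
qed simp

text \<open>The countable chain condition: by the counting bound only finitely many members have any
  given domain size.\<close>

lemma antichain_countable:
  fixes W :: "('a \<rightharpoonup> bool) set"
  assumes "\<And>p. p \<in> W \<Longrightarrow> finite (dom p)"
    and "\<And>p q. p \<in> W \<Longrightarrow> q \<in> W \<Longrightarrow> p \<noteq> q \<Longrightarrow> \<exists>x a b. p x = Some a \<and> q x = Some b \<and> a \<noteq> b"
  shows "countable W"
proof -
  have "finite {p \<in> W. card (dom p) = n}" for n
  proof (rule ccontr)
    assume "infinite {p \<in> W. card (dom p) = n}"
    then obtain P where P: "P \<subseteq> {p \<in> W. card (dom p) = n}" "finite P" "card P = Suc (2 ^ n)"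
      by (meson infinite_arbitrarily_large)
    have "card P \<le> 2 ^ n"
      by (rule finite_antichain_card) (use P assms in \<open>blast+\<close>)
    then show False using P by simp
  qed
  then have "countable (\<Union>n. {p \<in> W. card (dom p) = n})" by (intro countable_UN) (auto intro: countable_finite)
  moreover have "W = (\<Union>n. {p \<in> W. card (dom p) = n})" by auto
  ultimately show ?thesis by simp
qed

text \<open>Since regular open sets are closed under extension, for them this says that membership
  depends only on the coordinates in \<open>J\<close>.\<close>

definition supported :: "('a \<rightharpoonup> bool) set \<Rightarrow> 'a set \<Rightarrow> bool" where
  "supported U J \<longleftrightarrow> (\<forall>p\<in>U. p |` J \<in> U)"

text \<open>Zorn gives a maximal antichain \<open>W\<close> inside \<open>U\<close>, countable by
  the chain condition. The union \<open>J\<close> of its domains supports \<open>U\<close>, because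
  compatibility with members of \<open>W\<close> is decided on \<open>J\<close>.\<close>

lemma countable_support:
  assumes U: "regular_open I U"
  shows "\<exists>J. countable J \<and> J \<subseteq> I \<and> supported U J"
proof -
  define anti where "anti W \<longleftrightarrow> W \<subseteq> U \<and>
    (\<forall>p\<in>W. \<forall>q\<in>W. p \<noteq> q \<longrightarrow> (\<exists>x a b. p x = Some a \<and> q x = Some b \<and> a \<noteq> b))" for W
  have "\<exists>M\<in>Collect anti. \<forall>X\<in>Collect anti. M \<subseteq> X \<longrightarrow> X = M"
  proof (rule subset_Zorn')
    fix K assume K: "subset.chain (Collect anti) K"
    have "\<exists>x a b. p x = Some a \<and> q x = Some b \<and> a \<noteq> b"
      if pq: "p \<in> \<Union>K" "q \<in> \<Union>K" "p \<noteq> q" for p q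
    proof -
      obtain X Y where XY: "X \<in> K" "Y \<in> K" "p \<in> X" "q \<in> Y" using pq by auto
      then have "X \<subseteq> Y \<or> Y \<subseteq> X" using K unfolding subset.chain_def by auto
      then obtain Z where "Z \<in> K" "p \<in> Z" "q \<in> Z" using XY by auto
      moreover have "anti Z" using \<open>Z \<in> K\<close> K unfolding subset.chain_def by auto
      ultimately show ?thesis using pq unfolding anti_def by blast
    qed
    moreover have "\<Union>K \<subseteq> U" using K unfolding subset.chain_def anti_def by auto
    ultimately show "\<Union>K \<in> Collect anti" unfolding anti_def by blast
  qed
  then obtain W where W: "anti W" and max: "\<And>X. anti X \<Longrightarrow> W \<subseteq> X \<Longrightarrow> X = W" by auto
  have WC: "W \<subseteq> cohen_poset I" using W regular_openD[OF U] unfolding anti_def by auto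
  define J where "J = (\<Union>p\<in>W. dom p)"
  have "countable W"
    by (rule antichain_countable) (use W WC in \<open>auto simp: anti_def cohen_poset_def\<close>)
  then have "countable J"
    unfolding J_def using WC by (intro countable_UN) (auto simp: cohen_poset_def intro: countable_finite)
  moreover have "J \<subseteq> I" using WC unfolding J_def cohen_poset_def by auto
  moreover have "p |` J \<in> U" if p: "p \<in> U" for p
  proof (rule ccontr)
    assume n: "p |` J \<notin> U"
    have pC: "p \<in> cohen_poset I" using p regular_openD[OF U] by auto
    obtain q where q: "q \<in> cohen_poset I" "p |` J \<subseteq>\<^sub>m q" "\<And>r. r \<in> U \<Longrightarrow> \<not> q \<subseteq>\<^sub>m r"
      using regular_open_avoid[OF U cohen_poset_restrict[OF pC] n] by blast
    \<comment> \<open>Here \<open>q\<close> extends the restriction of \<open>p\<close> to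
      \<open>J\<close> but has no extension in \<open>U\<close>. The merge \<open>s\<close> is in
      \<open>U\<close> because it extends \<open>p\<close>, and it agrees with \<open>q\<close> on
      \<open>J\<close>. So a \<open>w\<close> in \<open>W\<close> compatible with \<open>s\<close>
      is compatible with \<open>q\<close>, and \<open>q ++ w\<close> is an extension of
      \<open>q\<close> in \<open>U\<close>.\<close>
    define s where "s = (q |` J) ++ p"
    have s: "s \<in> U" unfolding s_def
      by (rule regular_open_up[OF U p]) (simp_all add: cohen_poset_add cohen_poset_restrict q pC)
    have sJ: "s x = q x" if "x \<in> J" for x
    proof (cases "p x")
      case None then show ?thesis using that by (simp add: s_def map_add_def)
    next
      case (Some a)
      then have "(p |` J) x = Some a" using that by simp
      then have "q x = Some a" using q(2) by (metis domI map_le_def)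
      then show ?thesis using Some by (simp add: s_def)
    qed
    have "\<exists>w\<in>W. \<forall>x a b. s x = Some a \<longrightarrow> w x = Some b \<longrightarrow> a = b"
    proof (rule ccontr)
      assume *: "\<not> ?thesis"
      then have "anti (insert s W)" using W s unfolding anti_def by (simp, metis)
      then have "s \<in> W" using max by blast
      moreover have "\<forall>x a b. s x = Some a \<longrightarrow> s x = Some b \<longrightarrow> a = b" by simp
      ultimately show False using * by blast
    qed
    then obtain w where w: "w \<in> W" "\<And>x a b. s x = Some a \<Longrightarrow> w x = Some b \<Longrightarrow> a = b" by blast
    have wq: "q \<subseteq>\<^sub>m q ++ w"
    proof (rule map_le_addI)
      fix x a b assume "q x = Some a" "w x = Some b"
      moreover from this have "x \<in> J" using w(1) unfolding J_def by auto
      ultimately show "a = b" using w(2) sJ by metis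
    qed
    have "q ++ w \<in> U"
      by (rule regular_open_up[OF U, of w]) (use W w q WC in \<open>auto simp: anti_def intro!: cohen_poset_add\<close>)
    then show False using q(3) wq by blast
  qed
  ultimately show ?thesis unfolding supported_def by blast
qed

section \<open>Subalgebras of invariant regular open sets\<close>

text \<open>The relation \<open>R\<close> behaves like a bisimulation on the dense set of its reflexive points; it
  stands for equality of images under a projection of the Cohen poset.\<close>

locale bisimulation =
  fixes I :: "'a set" and R :: "('a \<rightharpoonup> bool) \<Rightarrow> ('a \<rightharpoonup> bool) \<Rightarrow> bool"
  assumes R_sym: "R p q \<Longrightarrow> R q p"
    and R_dom: "R p q \<Longrightarrow> p \<in> cohen_poset I"
    and R_dense: "p \<in> cohen_poset I \<Longrightarrow> \<exists>q. p \<subseteq>\<^sub>m q \<and> R q q"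
    and R_lift: "R p q \<Longrightarrow> q \<subseteq>\<^sub>m r \<Longrightarrow> R r r \<Longrightarrow> \<exists>p'. p \<subseteq>\<^sub>m p' \<and> R p' r"
begin

definition inv_alg :: "('a \<rightharpoonup> bool) set set" where
  "inv_alg = {U. regular_open I U \<and> (\<forall>p q. R p q \<longrightarrow> p \<in> U \<longrightarrow> q \<in> U)}"

lemma inv_alg_regular_open: "U \<in> inv_alg \<Longrightarrow> regular_open I U"
  by (simp add: inv_alg_def)

lemma inv_alg_invariant: "U \<in> inv_alg \<Longrightarrow> R p q \<Longrightarrow> p \<in> U \<Longrightarrow> q \<in> U"
  by (auto simp: inv_alg_def)

text \<open>Back and forth: an extension of \<open>q\<close> is lifted to the side of
  \<open>p\<close>, extended there into the family, and lifted back, where invariance keeps it in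
  the family. Stated for raw sets of conditions, so that it applies to \<open>elem_set\<close>
  below.\<close>

lemma inv_alg_sup:
  assumes sub: "\<Union>S \<subseteq> cohen_poset I"
    and inv: "\<And>p q. R p q \<Longrightarrow> p \<in> \<Union>S \<Longrightarrow> q \<in> \<Union>S"
    and refl: "\<And>p. p \<in> \<Union>S \<Longrightarrow> \<exists>q\<in>\<Union>S. p \<subseteq>\<^sub>m q \<and> R q q"
  shows "ro_sup I S \<in> inv_alg"
proof -
  have "q \<in> ro_sup I S" if R: "R p q" and p: "p \<in> ro_sup I S" for p q
  proof -
    have "\<exists>s\<in>\<Union>S. r \<subseteq>\<^sub>m s" if r: "r \<in> cohen_poset I" "q \<subseteq>\<^sub>m r" for r
    proof -
      obtain r1 where r1: "r \<subseteq>\<^sub>m r1" "R r1 r1" using R_dense r by blast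
      obtain p1 where p1: "p \<subseteq>\<^sub>m p1" "R p1 r1"
        using R_lift[OF R _ r1(2)] r r1 map_le_trans by blast
      obtain s where s: "s \<in> \<Union>S" "p1 \<subseteq>\<^sub>m s"
        using p p1 R_dom unfolding ro_sup_def by blast
      obtain s1 where s1: "s1 \<in> \<Union>S" "s \<subseteq>\<^sub>m s1" "R s1 s1" using refl s by blast
      obtain r2 where "r1 \<subseteq>\<^sub>m r2" "R r2 s1"
        using R_lift[OF R_sym[OF p1(2)] _ s1(3)] s s1 map_le_trans by blast
      then show ?thesis using inv R_sym s1 r1 map_le_trans by meson
    qed
    then show ?thesis using R_dom[OF R_sym[OF R]] unfolding ro_sup_def by blast
  qed
  then show ?thesis using ro_sup_regular_open[OF sub] unfolding inv_alg_def by blast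
qed

lemma inv_alg_sup':
  assumes "S \<subseteq> inv_alg"
  shows "ro_sup I S \<in> inv_alg"
proof (rule inv_alg_sup)
  show "\<Union>S \<subseteq> cohen_poset I" using assms inv_alg_regular_open regular_openD by blast
  show "q \<in> \<Union>S" if "R p q" "p \<in> \<Union>S" for p q
    using that assms inv_alg_invariant by blast
  show "\<exists>q\<in>\<Union>S. p \<subseteq>\<^sub>m q \<and> R q q" if p: "p \<in> \<Union>S" for p
  proof -
    obtain U where U: "U \<in> S" "p \<in> U" using p by blast
    then have ro: "regular_open I U" using assms inv_alg_regular_open by blast
    then obtain q where "p \<subseteq>\<^sub>m q" "R q q" using R_dense regular_openD U by blast
    then show ?thesis using U regular_open_up[OF ro] R_dom by blast
  qed
qed

lemma inv_alg_Inter: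
  assumes "S \<subseteq> inv_alg" "S \<noteq> {}"
  shows "\<Inter>S \<in> inv_alg"
  using regular_open_Inter[of S I] assms unfolding inv_alg_def by blast

lemma inv_alg_Int: "U \<in> inv_alg \<Longrightarrow> V \<in> inv_alg \<Longrightarrow> U \<inter> V \<in> inv_alg"
  using inv_alg_Inter[of "{U, V}"] by simp

lemma inv_alg_compl:
  assumes U: "U \<in> inv_alg"
  shows "ro_compl I U \<in> inv_alg"
proof -
  have "q \<in> ro_compl I U" if R: "R p q" and p: "p \<in> ro_compl I U" for p q
  proof -
    have "r \<notin> U" if r: "r \<in> cohen_poset I" "q \<subseteq>\<^sub>m r" for r
    proof
      assume rU: "r \<in> U"
      obtain r1 where r1: "r \<subseteq>\<^sub>m r1" "R r1 r1" using R_dense r by blast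
      have "r1 \<in> U" using rU r1 regular_open_up[OF inv_alg_regular_open[OF U]] R_dom by blast
      obtain p1 where p1: "p \<subseteq>\<^sub>m p1" "R p1 r1"
        using R_lift[OF R _ r1(2)] r r1 map_le_trans by blast
      then have "p1 \<in> U" using inv_alg_invariant[OF U] R_sym \<open>r1 \<in> U\<close> by blast
      then show False using p p1 R_dom unfolding ro_compl_def by blast
    qed
    then show ?thesis using R_dom[OF R_sym[OF R]] unfolding ro_compl_def by blast
  qed
  then show ?thesis using regular_open_compl[OF inv_alg_regular_open[OF U]]
    unfolding inv_alg_def by blast
qed

lemma inv_alg_empty: "{} \<in> inv_alg"
  by (simp add: inv_alg_def regular_open_empty)

lemma inv_alg_full: "cohen_poset I \<in> inv_alg"
  using R_dom R_sym regular_open_full unfolding inv_alg_def by blast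

text \<open>The supremum of \<open>W\<close> taken in the full algebra and its complement
  \<open>c\<close> both belong to \<open>inv_alg\<close>. As \<open>c\<close> is disjoint from every
  member of \<open>W\<close>, maximality makes it empty, so \<open>W\<close> has supremum one in the
  full algebra.\<close>

lemma inv_alg_maximal_antichain:
  assumes W: "maximal_antichain inv_alg W"
  shows "maximal_antichain (cohen_algebra I) W"
proof -
  have sub: "W \<subseteq> inv_alg" using W by (simp add: maximal_antichain_def)
  have ro: "regular_open I V" if "V \<in> W" for V
    using that sub inv_alg_regular_open by blast
  define c where "c = ro_compl I (ro_sup I W)"
  have c: "c \<in> inv_alg" unfolding c_def using inv_alg_compl inv_alg_sup' sub by blast
  have "c \<inter> V = {}" if "V \<in> W" for V
    using ro_sup_upper[OF that ro[OF that]] regular_openD[OF ro[OF that]]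
    unfolding c_def ro_compl_def using map_le_refl by blast
  then have c0: "c = {}" using W c unfolding maximal_antichain_def by meson
  have "\<exists>V\<in>W. U \<inter> V \<noteq> {}" if U: "regular_open I U" "U \<noteq> {}" for U
  proof -
    obtain p where p: "p \<in> U" using U by blast
    then have pC: "p \<in> cohen_poset I" using regular_openD U by blast
    then obtain q where q: "q \<in> cohen_poset I" "p \<subseteq>\<^sub>m q" "q \<in> ro_sup I W"
      using c0 unfolding c_def ro_compl_def by auto
    then have "\<exists>r\<in>\<Union>W. q \<subseteq>\<^sub>m r" unfolding ro_sup_def by simp
    then obtain V r where r: "V \<in> W" "r \<in> V" "q \<subseteq>\<^sub>m r" by blast
    then have "r \<in> U"
      using regular_open_up[OF U(1) p, of r] q(2) regular_openD[OF ro] map_le_trans[of p q r]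
      by blast
    then show ?thesis using r by blast
  qed
  moreover have "W \<subseteq> cohen_algebra I" using ro by (auto simp: cohen_algebra_def)
  ultimately show ?thesis using W unfolding maximal_antichain_def cohen_algebra_def by simp
qed

lemma inv_alg_complete_subalgebra: "complete_subalgebra I inv_alg"
proof -
  have "inv_alg \<subseteq> cohen_algebra I"
    using inv_alg_regular_open by (auto simp: cohen_algebra_def)
  then show ?thesis
    unfolding complete_subalgebra_def ro_subalgebra_def
    using inv_alg_empty inv_alg_full inv_alg_Int inv_alg_compl inv_alg_sup'
      inv_alg_maximal_antichain by simp
qed

text \<open>Each intersection is the least element of \<open>inv_alg\<close> containing
  \<open>p\<close>. This bounds the density by the number of conditions.\<close>

lemma inv_alg_dense_below:
  assumes b: "b \<in> inv_alg"
  shows "dense_below inv_alg b ((\<lambda>p. \<Inter>{U \<in> inv_alg. p \<in> U}) ` b)"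
proof -
  let ?E = "\<lambda>p. \<Inter>{U \<in> inv_alg. p \<in> U}"
  have "?E p \<in> {c \<in> inv_alg. c \<noteq> {} \<and> c \<subseteq> b}" if "p \<in> b" for p
    using that b inv_alg_Inter[of "{U \<in> inv_alg. p \<in> U}"] by auto
  then have "?E ` b \<subseteq> {c \<in> inv_alg. c \<noteq> {} \<and> c \<subseteq> b}" by blast
  moreover have "\<exists>d\<in>?E ` b. d \<subseteq> c" if c: "c \<in> inv_alg" "c \<noteq> {}" "c \<subseteq> b" for c
  proof -
    obtain p where p: "p \<in> c" using c by blast
    then have "?E p \<subseteq> c" using c(1) by (intro Inter_lower) simp
    then show ?thesis using p c(3) by blast
  qed
  ultimately show ?thesis unfolding dense_below_def by simp
qed

end

section \<open>Almost contained and almost disjoint reals around a hidden Cohen real\<close>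

text \<open>\<open>Z k\<close> is the \<open>k\<close>th bit of the hidden real \<open>z\<close>.  The real \<open>x\<^sub>j\<close> has the bits \<open>C j k\<close>, except that
  once some \<open>D j k'\<close> with \<open>k' < k\<close> is true, it may contain \<open>k\<close> only if \<open>z k = side j\<close>.\<close>

datatype 'j coord = Z nat | C 'j nat | D 'j nat

text \<open>The injection \<open>co\<close> lets the coordinates name elements of an arbitrary index
  type.\<close>

locale hidden_real =
  fixes co :: "'j coord \<Rightarrow> 'a" and side :: "'j \<Rightarrow> bool"
  assumes inj_co: "inj co"
begin

definition rect :: "nat \<Rightarrow> 'j set \<Rightarrow> 'a set" where
  "rect n F = co ` ({Z k | k. k < n} \<union> {C j k | j k. j \<in> F \<and> k < n} \<union> {D j k | j k. j \<in> F \<and> k < n})"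

definition promised :: "('a \<rightharpoonup> bool) \<Rightarrow> 'j \<Rightarrow> nat \<Rightarrow> bool" where
  "promised p j k \<longleftrightarrow> (\<exists>k'<k. p (co (D j k')) = Some True)"

definition val :: "('a \<rightharpoonup> bool) \<Rightarrow> 'j \<Rightarrow> nat \<Rightarrow> bool" where
  "val p j k \<longleftrightarrow> p (co (C j k)) = Some True \<and> (promised p j k \<longrightarrow> p (co (Z k)) = Some (side j))"

text \<open>The last clause makes every real in \<open>F\<close> obey \<open>z\<close> from
  \<open>n\<close> on. Two good conditions with the same \<open>n\<close> and \<open>F\<close> thus
  impose the same rule on all later bits of these reals, which makes lifting possible.\<close>

definition good :: "nat \<Rightarrow> 'j set \<Rightarrow> ('a \<rightharpoonup> bool) \<Rightarrow> bool" where
  "good n F p \<longleftrightarrow> finite F \<and> dom p = rect n F \<and> (\<forall>j\<in>F. promised p j n)"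

text \<open>Equality under the projection that keeps \<open>n\<close>, \<open>F\<close> and the
  initial segments of the reals, and hides the hidden real and the positions of the
  promises.\<close>

definition same_reals :: "('a \<rightharpoonup> bool) \<Rightarrow> ('a \<rightharpoonup> bool) \<Rightarrow> bool" where
  "same_reals p q \<longleftrightarrow>
    (\<exists>n F. good n F p \<and> good n F q \<and> (\<forall>j\<in>F. \<forall>k<n. val p j k = val q j k))"

text \<open>Used as \<open>mk n F g ++ p\<close>: the values of \<open>g\<close> fill those
  coordinates of the rectangle that \<open>p\<close> leaves undefined.\<close>

definition mk :: "nat \<Rightarrow> 'j set \<Rightarrow> ('j coord \<Rightarrow> bool) \<Rightarrow> 'a \<rightharpoonup> bool" where
  "mk n F g x = (if x \<in> rect n F then Some (g (inv co x)) else None)"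

section \<open>Calculus of rectangles and good conditions\<close>

lemma co_eq [simp]: "co c = co c' \<longleftrightarrow> c = c'"
  using inj_co by (auto dest: injD)

lemma inv_co [simp]: "inv co (co c) = c"
  using inj_co by (rule inv_f_f)

lemma rect_simps [simp]:
  "co (Z k) \<in> rect n F \<longleftrightarrow> k < n"
  "co (C j k) \<in> rect n F \<longleftrightarrow> j \<in> F \<and> k < n"
  "co (D j k) \<in> rect n F \<longleftrightarrow> j \<in> F \<and> k < n"
  unfolding rect_def by auto

lemma rect_mono: "n \<le> m \<Longrightarrow> F \<subseteq> G \<Longrightarrow> rect n F \<subseteq> rect m G"
  unfolding rect_def by auto

lemma rect_range: "rect n F \<subseteq> range co"
  unfolding rect_def by auto

lemma finite_rect: "finite F \<Longrightarrow> finite (rect n F)"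
proof -
  assume F: "finite F"
  have "rect n F \<subseteq> co ` (Z ` {..<n} \<union> (\<lambda>(j, k). C j k) ` (F \<times> {..<n}) \<union> (\<lambda>(j, k). D j k) ` (F \<times> {..<n}))"
    unfolding rect_def by force
  then show ?thesis by (rule finite_subset) (use F in auto)
qed

lemma dom_mk [simp]: "dom (mk n F g) = rect n F"
  by (auto simp: mk_def split: if_splits)

lemma mk_add:
  "(mk n F g ++ p) (co c) = (if co c \<in> dom p then p (co c) else if co c \<in> rect n F then Some (g c) else None)"
  by (auto simp: map_add_def mk_def split: option.split)

lemma good_cohen_poset: "good n F p \<Longrightarrow> p \<in> cohen_poset (range co)"
  using rect_range finite_rect unfolding good_def cohen_poset_def by auto

lemma good_promised_pos: "good n F p \<Longrightarrow> j \<in> F \<Longrightarrow> 0 < n"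
  unfolding good_def promised_def by (auto intro: gr0I)

lemma promised_mono: "promised p j k \<Longrightarrow> p \<subseteq>\<^sub>m q \<Longrightarrow> k \<le> k' \<Longrightarrow> promised q j k'"
  unfolding promised_def map_le_def using domI order_less_le_trans by metis

lemma good_le_size:
  assumes p: "good n F p" and q: "good m G q" and le: "p \<subseteq>\<^sub>m q"
  shows "n \<le> m" "F \<subseteq> G"
proof -
  have sub: "rect n F \<subseteq> rect m G"
    using map_le_implies_dom_le[OF le] p q by (simp add: good_def)
  have "k < m" if "k < n" for k
    using sub that rect_simps(1)[of k] by blast
  then show "n \<le> m" by (meson leI order_less_irrefl)
  show "F \<subseteq> G"
  proof
    fix j assume j: "j \<in> F"
    then have "co (C j 0) \<in> rect n F" using good_promised_pos[OF p j] by simp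
    then show "j \<in> G" using sub rect_simps(2) by blast
  qed
qed

text \<open>The \<open>k\<close>th bit reads only \<open>Z k\<close>, \<open>C j k\<close> and
  earlier coordinates \<open>D j k'\<close>, all in the rectangle on which \<open>p\<close> is
  already defined.\<close>

lemma good_le_val:
  assumes p: "good n F p" and le: "p \<subseteq>\<^sub>m q" and j: "j \<in> F" "k < n"
  shows "val q j k = val p j k"
proof -
  have dom: "dom p = rect n F" using p by (simp add: good_def)
  have eq: "q (co c) = p (co c)" if "co c \<in> rect n F" for c
    using le that unfolding map_le_def dom by metis
  have "q (co (D j k')) = p (co (D j k'))" if "k' < k" for k'
    using eq that j by simp
  then have "promised q j k = promised p j k" unfolding promised_def by auto
  then show ?thesis using eq j unfolding val_def by simp
qed

lemma good_extend:
  assumes p: "p \<in> cohen_poset (range co)" and F0: "finite F0"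
  shows "\<exists>n F q. N < n \<and> F0 \<subseteq> F \<and> good n F q \<and> p \<subseteq>\<^sub>m q"
proof -
  define S where "S = inv co ` dom p"
  have fS: "finite S" using p by (simp add: S_def cohen_poset_def)
  have dom: "dom p \<subseteq> co ` S" using p unfolding S_def cohen_poset_def by force
  define num :: "'j coord \<Rightarrow> nat" 
    where "num = case_coord (\<lambda>k. k) (\<lambda>_ k. k) (\<lambda>_ k. k)"
  define own :: "'j coord \<Rightarrow> 'j set" 
    where "own = case_coord (\<lambda>_. {}) (\<lambda>j _. {j}) (\<lambda>j _. {j})"
  define n where "n = Suc (Max (insert N (num ` S)))"
  define F where "F = F0 \<union> (\<Union>c\<in>S. own c)"
  have "finite (own c)" for c by (cases c) (auto simp: own_def)
  then have fF: "finite F" using F0 fS by (auto simp: F_def)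
  have num: "num c < n" if "c \<in> S" for c
    using that fS unfolding n_def by (auto intro!: le_imp_less_Suc)
  have "N < n" using fS unfolding n_def by (auto intro!: le_imp_less_Suc)
  have "co c \<in> rect n F" if "c \<in> S" for c
    using num[OF that] that by (cases c) (auto simp: num_def own_def F_def intro!: bexI)
  then have domn: "dom p \<subseteq> rect n F" using dom by auto
  \<comment> \<open>The rectangle below \<open>n\<close> contains the domain of \<open>p\<close>.
    One further position is added, so that \<open>D j n\<close> is still free to carry the promise
    of each real in \<open>F\<close>.\<close>
  define q where "q = mk (Suc n) F (\<lambda>c. case c of D j k \<Rightarrow> True | _ \<Rightarrow> False) ++ p"
  have "dom q = rect (Suc n) F"
    using domn rect_mono[of n "Suc n" F F] by (auto simp: q_def)
  moreover have "promised q j (Suc n)" if "j \<in> F" for j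
  proof -
    have "co (D j n) \<notin> dom p" using domn rect_simps(3)[of j n n F] by blast
    then have "q (co (D j n)) = Some True" using that by (simp add: q_def mk_add)
    then show ?thesis unfolding promised_def by blast
  qed
  ultimately have "good (Suc n) F q" using fF by (simp add: good_def)
  moreover have "p \<subseteq>\<^sub>m q" by (simp add: q_def)
  moreover have "F0 \<subseteq> F" by (auto simp: F_def)
  ultimately show ?thesis using \<open>N < n\<close> less_SucI by blast
qed

lemma same_reals_refl: "good n F p \<Longrightarrow> same_reals p p"
  unfolding same_reals_def by blast

text \<open>The reals of \<open>r\<close> not in \<open>F\<close> can be copied to the extension of \<open>p\<close> despite the
  different values of \<open>z\<close> below \<open>n\<close>, by delaying their promise to the last position.\<close>

lemma same_reals_lift:
  assumes "same_reals p q" and le: "q \<subseteq>\<^sub>m r" and "same_reals r r"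
  shows "\<exists>p'. p \<subseteq>\<^sub>m p' \<and> same_reals p' r"
proof -
  obtain n F where p: "good n F p" and q: "good n F q"
    and pq: "\<And>j k. j \<in> F \<Longrightarrow> k < n \<Longrightarrow> val p j k = val q j k"
    using assms(1) unfolding same_reals_def by blast
  obtain m G where r: "good m G r" using assms(3) unfolding same_reals_def by blast
  have nm: "n \<le> m" and FG: "F \<subseteq> G" using good_le_size[OF q r le] by auto
  have fG: "finite G" and domr: "dom r = rect m G" using r by (auto simp: good_def)
  have domp: "dom p = rect n F" using p by (simp add: good_def)
  \<comment> \<open>Off \<open>p\<close>, the hidden real is copied from \<open>r\<close>, each real
    receives its bits in \<open>r\<close> directly, and \<open>D j k\<close> is true only at the
    last position. A promise binds strictly later positions, so this one satisfies
    \<open>good\<close> without constraining any bit below \<open>m\<close>.\<close>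
  define p' where "p' = mk m G (\<lambda>c. case c of Z k \<Rightarrow> r (co (Z k)) = Some True
      | C j k \<Rightarrow> val r j k | D j k \<Rightarrow> Suc k = m) ++ p"
  have le': "p \<subseteq>\<^sub>m p'" by (simp add: p'_def)
  have p'D: "p' (co (D j k)) = (if j \<in> F \<and> k < n then p (co (D j k)) else Some (Suc k = m))"
    if "j \<in> G" "k < m" for j k
    using that by (simp add: p'_def mk_add domp)
  have p'C: "p' (co (C j k)) = Some (val r j k)"
    if "j \<in> G" "k < m" "\<not> (j \<in> F \<and> k < n)" for j k
    using that by (auto simp: p'_def mk_add domp)
  have p'Z: "p' (co (Z k)) = r (co (Z k))" if "k < m" "\<not> k < n" for k
  proof -
    have "co (Z k) \<in> dom r" using that domr by simp
    then obtain b where "r (co (Z k)) = Some b" by blast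
    then show ?thesis using that by (simp add: p'_def mk_add domp)
  qed
  have "promised p' j m" if j: "j \<in> G" for j
  proof (cases "j \<in> F")
    case True
    then have "promised p j n" using p by (simp add: good_def)
    then show ?thesis using promised_mono le' nm by blast
  next
    case False
    have "0 < m" using good_promised_pos[OF r j] .
    then have "p' (co (D j (m - 1))) = Some True" using p'D[OF j, of "m - 1"] False by simp
    then show ?thesis using \<open>0 < m\<close> unfolding promised_def by (metis diff_less zero_less_one)
  qed
  moreover have "dom p' = rect m G"
    using domp rect_mono[OF nm FG] by (auto simp: p'_def)
  ultimately have good: "good m G p'" using fG by (simp add: good_def)
  have "val p' j k = val r j k" if jk: "j \<in> G" "k < m" for j k
  proof (cases "j \<in> F")
    case jF: True
    show ?thesis
    proof (cases "k < n")
      case True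
      then show ?thesis
        using good_le_val[OF p le' jF True] good_le_val[OF q le jF True] pq[OF jF True] by simp
    next
      case False
      \<comment> \<open>From \<open>n\<close> on, both sides are under a promise and share the bits
        of the hidden real, so setting \<open>C j k\<close> to \<open>val r j k\<close> reproduces
        this value.\<close>
      then have "promised p j n" "promised q j n" using p q jF by (auto simp: good_def)
      then have "promised p' j k" "promised r j k"
        using promised_mono le le' False by (meson leI)+
      then show ?thesis using p'C[OF jk] p'Z[OF jk(2) False] False by (auto simp: val_def)
    qed
  next
    case False
    then have "p' (co (D j k')) = Some (Suc k' = m)" if "k' < k" for k'
      using p'D[OF jk(1), of k'] that jk by simp
    then have "\<not> promised p' j k" using jk unfolding promised_def by auto
    then show ?thesis using p'C[OF jk] False by (simp add: val_def)
  qed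
  then have "same_reals p' r" using good r unfolding same_reals_def by blast
  then show ?thesis using le' by blast
qed

sublocale bisimulation "range co" same_reals
proof
  show "same_reals q p" if "same_reals p q" for p q
    using that unfolding same_reals_def by metis
  show "p \<in> cohen_poset (range co)" if "same_reals p q" for p q
    using that good_cohen_poset unfolding same_reals_def by blast
  show "\<exists>q. p \<subseteq>\<^sub>m q \<and> same_reals q q" if "p \<in> cohen_poset (range co)" for p
    using good_extend[OF that finite.emptyI] same_reals_refl by blast
qed (rule same_reals_lift)

section \<open>Boolean values of the bits of the reals\<close>

definition elem_set :: "'j \<Rightarrow> nat \<Rightarrow> ('a \<rightharpoonup> bool) set" where
  "elem_set j k = {p. \<exists>n F. good n F p \<and> j \<in> F \<and> k < n \<and> val p j k}"

text \<open>The Boolean value of the statement that \<open>k\<close> lies in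
  \<open>x\<^sub>j\<close>: the supremum regularizes the set of good conditions that are large
  enough to decide this positively.\<close>

definition elem :: "'j \<Rightarrow> nat \<Rightarrow> ('a \<rightharpoonup> bool) set" where
  "elem j k = ro_sup (range co) {elem_set j k}"

lemma elem_set_extend:
  "p \<in> elem_set j k \<Longrightarrow> p \<subseteq>\<^sub>m q \<Longrightarrow> good m G q \<Longrightarrow> q \<in> elem_set j k"
proof -
  assume p: "p \<in> elem_set j k" and le: "p \<subseteq>\<^sub>m q" and q: "good m G q"
  obtain n F where nF: "good n F p" "j \<in> F" "k < n" "val p j k"
    using p unfolding elem_set_def by blast
  have "j \<in> G" "k < m" using good_le_size[OF nF(1) q le] nF by auto
  moreover have "val q j k" using good_le_val[OF nF(1) le nF(2,3)] nF(4) by simp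
  ultimately show ?thesis using q unfolding elem_set_def by blast
qed

lemma elem_inv_alg: "elem j k \<in> inv_alg"
  unfolding elem_def
proof (rule inv_alg_sup; simp)
  show "elem_set j k \<subseteq> cohen_poset (range co)"
    using good_cohen_poset by (auto simp: elem_set_def)
  show "\<exists>q\<in>elem_set j k. p \<subseteq>\<^sub>m q \<and> same_reals q q" if "p \<in> elem_set j k" for p
    using that same_reals_refl map_le_refl unfolding elem_set_def by blast
  show "q \<in> elem_set j k" if R: "same_reals p q" and p: "p \<in> elem_set j k" for p q
  proof -
    obtain n F where nF: "good n F p" "good n F q" "\<And>j k. j \<in> F \<Longrightarrow> k < n \<Longrightarrow> val p j k = val q j k"
      using R unfolding same_reals_def by blast
    obtain m G where mG: "good m G p" "j \<in> G" "k < m" "val p j k"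
      using p unfolding elem_set_def by blast
    have "m \<le> n" "G \<subseteq> F" using good_le_size[OF mG(1) nF(1) map_le_refl] by auto
    then have "j \<in> F" "k < n" using mG by auto
    then show ?thesis using nF mG unfolding elem_set_def by blast
  qed
qed

lemma elem_set_elem: "elem_set j k \<subseteq> elem j k"
proof
  fix p assume p: "p \<in> elem_set j k"
  then have pC: "p \<in> cohen_poset (range co)" using good_cohen_poset by (auto simp: elem_set_def)
  have "\<exists>r\<in>elem_set j k. q \<subseteq>\<^sub>m r" if q: "q \<in> cohen_poset (range co)" "p \<subseteq>\<^sub>m q" for q
  proof -
    obtain n F r where "good n F r" "q \<subseteq>\<^sub>m r" using good_extend[OF q(1) finite.emptyI] by blast
    then show ?thesis using elem_set_extend[OF p] q(2) map_le_trans by blast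
  qed
  then show "p \<in> elem j k" using pC unfolding elem_def ro_sup_def by simp
qed

lemma elem_val:
  assumes "p \<in> elem j k" "good n F p" "j \<in> F" "k < n"
  shows "val p j k"
proof -
  obtain r where r: "r \<in> elem_set j k" "p \<subseteq>\<^sub>m r"
    using assms(1) map_le_refl unfolding elem_def ro_sup_def by blast
  then obtain m G where mG: "good m G r" "val r j k" unfolding elem_set_def by blast
  then show ?thesis using good_le_val[OF assms(2) r(2) assms(3,4)] by simp
qed

lemma good_extend_in:
  assumes U: "regular_open (range co) U" and p: "p \<in> U" and F0: "finite F0"
  shows "\<exists>n F q. N < n \<and> F0 \<subseteq> F \<and> good n F q \<and> p \<subseteq>\<^sub>m q \<and> q \<in> U"
proof -
  have "p \<in> cohen_poset (range co)" using p regular_openD[OF U] by blast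
  then obtain n F q where q: "N < n" "F0 \<subseteq> F" "good n F q" "p \<subseteq>\<^sub>m q"
    using good_extend[OF _ F0, of p N] by blast
  then have "q \<in> U" using regular_open_up[OF U p q(4) good_cohen_poset] by blast
  then show ?thesis using q by blast
qed

text \<open>Position 0 is never under a promise, so bit 0 of the real \<open>j\<close> is just the
  Cohen coordinate \<open>C j 0\<close>, and both values remain possible while that coordinate is
  undefined.\<close>

lemma elem_extend:
  assumes p: "p \<in> cohen_poset (range co)" and j: "co (C j 0) \<notin> dom p"
  shows "p \<notin> elem j 0" "\<exists>q\<in>elem j 0. p \<subseteq>\<^sub>m q"
proof -
  have ex: "\<exists>n F q. 0 < n \<and> j \<in> F \<and> good n F q \<and> p \<subseteq>\<^sub>m q \<and> val q j 0 = b" for b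
  proof -
    have pb: "p(co (C j 0) \<mapsto> b) \<in> cohen_poset (range co)"
      using p by (auto simp: cohen_poset_def)
    obtain n F q where q: "0 < n" "{j} \<subseteq> F" "good n F q" "p(co (C j 0) \<mapsto> b) \<subseteq>\<^sub>m q"
      using good_extend[OF pb, of "{j}" 0] by blast
    have "p \<subseteq>\<^sub>m p(co (C j 0) \<mapsto> b)" using j by (auto simp: map_le_def)
    then have "p \<subseteq>\<^sub>m q" using q(4) map_le_trans by blast
    moreover have "q (co (C j 0)) = Some b" using q(4) by (simp add: map_le_def)
    then have "val q j 0 = b" by (simp add: val_def promised_def)
    ultimately show ?thesis using q by blast
  qed
  show "p \<notin> elem j 0"
  proof
    assume "p \<in> elem j 0"
    moreover obtain n F q where "0 < n" "j \<in> F" "good n F q" "p \<subseteq>\<^sub>m q" "\<not> val q j 0"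
      using ex[of False] by blast
    ultimately show False
      using elem_val regular_open_up[OF inv_alg_regular_open[OF elem_inv_alg]] good_cohen_poset
      by metis
  qed
  show "\<exists>q\<in>elem j 0. p \<subseteq>\<^sub>m q"
    using ex[of True] elem_set_elem unfolding elem_set_def by blast
qed

text \<open>The witness is the Boolean value of the statement that the two reals are disjoint. It is
  nonzero because promises at position 0 put the later parts of the two reals on opposite sides of
  the hidden real.\<close>

lemma disjoint_promise:
  assumes ij: "side i \<noteq> side j"
  shows "\<exists>b\<in>inv_alg. b \<noteq> {} \<and> (\<forall>k. b \<inter> elem i k \<inter> elem j k = {})"
proof -
  define S where "S = range (\<lambda>k. elem i k \<inter> elem j k)"
  have S: "S \<subseteq> inv_alg" using elem_inv_alg inv_alg_Int by (auto simp: S_def)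
  define b where "b = ro_compl (range co) (ro_sup (range co) S)"
  have b: "b \<in> inv_alg" unfolding b_def using S inv_alg_sup' inv_alg_compl by blast
  have "b \<inter> (elem i k \<inter> elem j k) = {}" for k
  proof -
    have U: "elem i k \<inter> elem j k \<in> S" by (auto simp: S_def)
    then have "regular_open (range co) (elem i k \<inter> elem j k)" using S inv_alg_regular_open by blast
    from ro_sup_upper[OF U this] regular_openD[OF this] show ?thesis
      using map_le_refl unfolding b_def ro_compl_def by blast
  qed
  \<comment> \<open>A promise at 0 acts only from position 1 on, so position 0 is kept out of both
    reals by setting their bits \<open>C l 0\<close> to false.\<close>
  moreover define p where "p = mk 1 {i, j} (\<lambda>c. case c of D _ _ \<Rightarrow> True | _ \<Rightarrow> False)"
  have pv: "p (co (C l 0)) = Some False" "p (co (D l 0)) = Some True" if "l \<in> {i, j}" for l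
    using that unfolding p_def by (simp_all add: mk_def)
  have "p \<in> cohen_poset (range co)"
    using finite_rect[of "{i, j}" 1] rect_range by (auto simp: cohen_poset_def p_def)
  moreover have "q \<notin> ro_sup (range co) S" if q: "p \<subseteq>\<^sub>m q" "q \<in> cohen_poset (range co)" for q
  proof
    assume "q \<in> ro_sup (range co) S"
    then obtain k r where r: "q \<subseteq>\<^sub>m r" "r \<in> elem i k" "r \<in> elem j k"
      using q map_le_refl unfolding ro_sup_def S_def by blast
    then obtain n F s where s: "k < n" "{i, j} \<subseteq> F" "good n F s" "r \<subseteq>\<^sub>m s" 
      and "s \<in> elem i k \<inter> elem j k"
      using good_extend_in[OF inv_alg_regular_open[OF inv_alg_Int[OF elem_inv_alg elem_inv_alg]],
          of r i k j k "{i, j}" k] by blast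
    then have v: "val s i k" "val s j k" using elem_val s by auto
    have le: "p \<subseteq>\<^sub>m s" using q r s map_le_trans by metis
    have sv: "s (co (C l 0)) = Some False" "s (co (D l 0)) = Some True" if "l \<in> {i, j}" for l
      using pv[OF that] le unfolding map_le_def by (metis domI)+
    have "k \<noteq> 0" using v(1) sv(1)[of i] unfolding val_def by (intro notI) simp
    then have "promised s i k" "promised s j k" using sv unfolding promised_def by auto
    then show False using v ij unfolding val_def by simp
  qed
  ultimately have "p \<in> b" unfolding b_def ro_compl_def by blast
  then show ?thesis using b \<open>\<And>k. b \<inter> (elem i k \<inter> elem j k) = {}\<close> by (metis Int_assoc empty_iff)
qed

section \<open>Overlap of reals of different kinds under separate information\<close>

definition own :: "'j \<Rightarrow> 'a set" where
  "own j = co ` (range (C j) \<union> range (D j))"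

lemma own_simps [simp]:
  "co (Z k) \<notin> own j" "co (C i k) \<in> own j \<longleftrightarrow> i = j" "co (D i k) \<in> own j \<longleftrightarrow> i = j"
  unfolding own_def by auto

text \<open>Forgetting the promise of \<open>x\<^sub>b\<close> allows \<open>n\<close> to be put into \<open>x\<^sub>a\<close> and \<open>x\<^sub>b\<close>.
  By symmetry in \<open>a\<close> and \<open>b\<close>, the outcome can be reached after forgetting either promise.\<close>

lemma good_overlap:
  assumes q: "good n F q" and ab: "a \<in> F" "b \<in> F" "a \<noteq> b"
  shows "\<exists>r. good (Suc n) F r \<and> q |` (- own b) \<subseteq>\<^sub>m r \<and>
    (\<forall>j\<in>F. \<forall>k<Suc n. val r j k = (if k = n then j = a \<or> j = b else val q j k))"
proof -
  define q' where "q' = q |` (- own b)"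
  \<comment> \<open>\<open>Z n = side a\<close> lets \<open>a\<close> receive \<open>n\<close> while
    keeping its promise. The bits of \<open>b\<close> below \<open>n\<close> are written directly
    into \<open>C b k\<close>, and its promise is moved to \<open>n\<close>; this does not bind
    position \<open>n\<close> itself, so \<open>n\<close> may enter the real \<open>b\<close>
    too.\<close>
  define r where "r = mk (Suc n) F (\<lambda>c. case c of Z k \<Rightarrow> side a
      | C j k \<Rightarrow> (if k = n then j = a \<or> j = b else val q j k) | D j k \<Rightarrow> k = n) ++ q'"
  have domq: "dom q = rect n F" and fF: "finite F" using q by (auto simp: good_def)
  have "dom q' \<subseteq> rect n F" by (auto simp: q'_def domq)
  then have domr: "dom r = rect (Suc n) F"
    using rect_mono[of n "Suc n" F F] by (auto simp: r_def)
  have rZ: "r (co (Z k)) = (if k < n then q (co (Z k)) else Some (side a))" if "k < Suc n" for k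
    using that by (simp add: r_def mk_add q'_def domq)
  have rC: "r (co (C j k)) = (if k < n \<and> j \<noteq> b then q (co (C j k)) else
      Some (if k = n then j = a \<or> j = b else val q j k))" if "k < Suc n" "j \<in> F" for j k
    using that by (simp add: r_def mk_add q'_def domq)
  have rD: "r (co (D j k)) = (if k < n \<and> j \<noteq> b then q (co (D j k)) else Some (k = n))"
    if "k < Suc n" "j \<in> F" for j k
    using that by (simp add: r_def mk_add q'_def domq)
  have "promised r j (Suc n)" if "j \<in> F" for j
    unfolding promised_def using rD[of n j] that by auto
  then have good: "good (Suc n) F r" using fF domr by (simp add: good_def)
  have "val r j k = (if k = n then j = a \<or> j = b else val q j k)" if jk: "j \<in> F" "k < Suc n" for j k
  proof (cases "j = b")
    case True
    then have "\<not> promised r j k" using rD[of _ j] jk unfolding promised_def by auto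
    then show ?thesis using rC[of k j] jk True unfolding val_def by auto
  next
    case False
    have eq: "promised r j k = promised q j k"
    proof -
      have "r (co (D j k')) = q (co (D j k'))" if "k' < k" for k'
        using rD[of k' j] that jk False by auto
      then show ?thesis unfolding promised_def by auto
    qed
    show ?thesis
    proof (cases "k = n")
      case True
      then show ?thesis using rC[of k j] rZ[of k] jk False unfolding val_def by auto
    next
      case kn: False
      then show ?thesis using rC[of k j] rZ[of k] jk False eq unfolding val_def by auto
    qed
  qed
  then show ?thesis using good unfolding r_def q'_def by (auto intro: exI)
qed

text \<open>The two versions of \<open>good_overlap\<close>, forgetting the promise of
  \<open>b\<close> or that of \<open>a\<close>, end in conditions with the same reals. One lies in
  \<open>W\<close>, the other in \<open>W'\<close>, and invariance of \<open>W'\<close> brings them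
  together.\<close>

lemma overlap:
  assumes W: "W \<in> inv_alg" "W' \<in> inv_alg" and ne: "W \<inter> W' \<noteq> {}" and ab: "a \<noteq> b"
    and W_b: "\<And>p. p \<in> W \<Longrightarrow> p |` (- own b) \<in> W"
    and W'_a: "\<And>p. p \<in> W' \<Longrightarrow> p |` (- own a) \<in> W'"
  shows "\<exists>k. W \<inter> W' \<inter> elem a k \<inter> elem b k \<noteq> {}"
proof -
  have ro: "regular_open (range co) W" "regular_open (range co) W'" "regular_open (range co) (W \<inter> W')"
    using W inv_alg_regular_open inv_alg_Int by auto
  obtain p where "p \<in> W \<inter> W'" using ne by blast
  then obtain n F q where q: "{a, b} \<subseteq> F" "good n F q" "q \<in> W \<inter> W'"
    using good_extend_in[OF ro(3), of p "{a, b}" 0] by auto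
  obtain r where r: "good (Suc n) F r" "q |` (- own b) \<subseteq>\<^sub>m r"
    "\<And>j k. j \<in> F \<Longrightarrow> k < Suc n \<Longrightarrow> val r j k = (if k = n then j = a \<or> j = b else val q j k)"
    using good_overlap[OF q(2), of a b] q(1) ab by auto
  obtain r' where r': "good (Suc n) F r'" "q |` (- own a) \<subseteq>\<^sub>m r'"
    "\<And>j k. j \<in> F \<Longrightarrow> k < Suc n \<Longrightarrow> val r' j k = (if k = n then j = b \<or> j = a else val q j k)"
    using good_overlap[OF q(2), of b a] q(1) ab by auto
  have "r \<in> W" using regular_open_up[OF ro(1) W_b r(2)] q(3) good_cohen_poset r(1) by blast
  have "r' \<in> W'" using regular_open_up[OF ro(2) W'_a r'(2)] q(3) good_cohen_poset r'(1) by blast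
  moreover have "same_reals r' r" 
    unfolding same_reals_def using r(1) r'(1) r(3) r'(3) by (intro exI[of _ "Suc n"] exI[of _ F]) auto
  ultimately have "r \<in> W'" using inv_alg_invariant[OF W(2)] by blast
  moreover have "r \<in> elem_set a n" "r \<in> elem_set b n"
    using r q(1) unfolding elem_set_def by auto
  ultimately show ?thesis using elem_set_elem \<open>r \<in> W\<close> by blast
qed

end

section \<open>Cardinalities\<close>

unbundle cardinal_syntax

lemma Card_order_aleph1: "Card_order (cardSuc natLeq)"
  by (rule cardSuc_Card_order[OF natLeq_Card_order])

lemma infinite_aleph1: "infinite (Field (cardSuc natLeq))"
  using cardSuc_finite[OF natLeq_Card_order] Field_natLeq by simp

lemma Card_order_aleph2: "Card_order aleph2"
  unfolding aleph2_def by (rule cardSuc_Card_order[OF Card_order_aleph1])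

lemma infinite_aleph2: "infinite (Field aleph2)"
  unfolding aleph2_def using cardSuc_finite[OF Card_order_aleph1] infinite_aleph1 by simp

lemma natLeq_aleph1: "natLeq \<le>o cardSuc natLeq"
  by (rule cardSuc_ordLeq[OF natLeq_Card_order])

lemma aleph1_aleph2: "cardSuc natLeq \<le>o aleph2"
  unfolding aleph2_def by (rule cardSuc_ordLeq[OF Card_order_aleph1])

lemma countable_aleph1: "countable A \<Longrightarrow> |A| \<le>o cardSuc natLeq"
  by (rule ordLeq_transitive[OF _ natLeq_aleph1]) (simp add: countable_card_le_natLeq)

lemma less_aleph2: "\<not> aleph2 \<le>o |A| \<longleftrightarrow> |A| \<le>o cardSuc natLeq"
proof -
  have "\<not> aleph2 \<le>o |A| \<longleftrightarrow> |A| <o aleph2"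
    using Card_order_aleph2 card_of_Card_order not_ordLeq_iff_ordLess
    unfolding card_order_on_def by blast
  then show ?thesis
    unfolding aleph2_def using cardSuc_ordLeq_ordLess[OF Card_order_aleph1 card_of_Card_order] by simp
qed

lemma UN_aleph1:
  assumes "|X| \<le>o cardSuc natLeq" "\<And>x. x \<in> X \<Longrightarrow> countable (f x)"
  shows "|\<Union>x\<in>X. f x| \<le>o cardSuc natLeq"
  by (intro card_of_UNION_ordLeq_infinite_Field[OF infinite_aleph1 Card_order_aleph1 assms(1)]
    ballI countable_aleph1 assms(2))

text \<open>Take a set \<open>X\<close> of aleph-one indices tagged \<open>False\<close>. Their sets
  \<open>G (x, False)\<close> involve at most aleph-one indices in all, so some \<open>y\<close>
  escapes them; and the countable set \<open>G (y, True)\<close> cannot involve all of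
  \<open>X\<close>.\<close>

lemma free_pair:
  fixes G :: "'i \<times> bool \<Rightarrow> ('i \<times> bool) set"
  assumes G: "\<And>j. countable (G j)" and large: "aleph2 \<le>o |UNIV :: 'i set|"
  shows "\<exists>a b. snd a \<noteq> snd b \<and> a \<notin> G b \<and> b \<notin> G a"
proof -
  have "|Field (cardSuc natLeq)| \<le>o |UNIV :: 'i set|"
    using card_of_Field_ordIso[OF Card_order_aleph1] aleph1_aleph2 large
      ordIso_ordLeq_trans ordLeq_transitive by blast
  then obtain f :: "nat set \<Rightarrow> 'i" where f: "inj_on f (Field (cardSuc natLeq))"
    using card_of_ordLeq[of "Field (cardSuc natLeq)" "UNIV :: 'i set"] by auto
  define X where "X = f ` Field (cardSuc natLeq)"
  have X1: "|X| =o cardSuc natLeq"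
  proof -
    have "|Field (cardSuc natLeq)| =o |X|"
      unfolding X_def by (rule card_of_ordIsoI[OF inj_on_imp_bij_betw[OF f]])
    from ordIso_transitive[OF ordIso_symmetric[OF this] card_of_Field_ordIso[OF Card_order_aleph1]]
    show ?thesis .
  qed
  define Y where "Y = (\<Union>x\<in>X. fst ` G (x, False))"
  have "|Y| \<le>o cardSuc natLeq"
    unfolding Y_def using X1 ordIso_imp_ordLeq G by (intro UN_aleph1) auto
  then have "Y \<noteq> UNIV" using large less_aleph2 by metis
  then obtain y where y: "y \<notin> Y" by blast
  have "\<not> X \<subseteq> fst ` G (y, True)"
  proof
    assume "X \<subseteq> fst ` G (y, True)"
    then have "countable X" by (rule countable_subset) (simp add: G)
    then have "|X| \<le>o natLeq" by (simp add: countable_card_le_natLeq)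
    then have "cardSuc natLeq \<le>o natLeq" by (rule ordIso_ordLeq_trans[OF ordIso_symmetric[OF X1]])
    then show False using cardSuc_greater[OF natLeq_Card_order] not_ordLess_ordLeq by blast
  qed
  then obtain x where x: "x \<in> X" "x \<notin> fst ` G (y, True)" by blast
  have "(y, True) \<notin> G (x, False)" using x(1) y unfolding Y_def by force
  moreover have "(x, False) \<notin> G (y, True)" using x(2) by force
  ultimately show ?thesis by (metis snd_conv)
qed

section \<open>Sizes of the Cohen poset and of the coordinate set\<close>

lemma finite_ordLeq_infinite: "finite A \<Longrightarrow> infinite B \<Longrightarrow> |A| \<le>o |B|"
  by (rule ordLess_imp_ordLeq[OF finite_ordLess_infinite[OF card_of_Well_order card_of_Well_order]])
    (simp_all add: Field_card_of)

text \<open>Induction on the domain size: a condition with \<open>n + 1\<close> values arises from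
  one with \<open>n\<close> values by adding a coordinate and a bit. Then a countable union is
  taken.\<close>

lemma card_cohen_poset:
  assumes I: "infinite I"
  shows "|cohen_poset I| \<le>o |I|"
proof -
  note times = card_of_Times_ordLeq_infinite_Field[of "|I|", OF _ _ _ card_of_Card_order]
  have F: "infinite (Field |I| )" using I by (simp add: Field_card_of)
  have bool: "|UNIV :: bool set| \<le>o |I|" using I by (simp add: finite_ordLeq_infinite)
  define P where "P n = {p \<in> cohen_poset I. card (dom p) = n}" for n
  have P: "|P n| \<le>o |I|" for n
  proof (induction n)
    case 0
    have "P 0 \<subseteq> {Map.empty}" by (auto simp: P_def cohen_poset_def)
    then have "finite (P 0)" by (rule finite_subset) simp
    then show ?case using I by (simp add: finite_ordLeq_infinite)
  next
    case (Suc n)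
    have "P (Suc n) \<subseteq> (\<lambda>(p, x, b). p(x \<mapsto> b)) ` (P n \<times> I \<times> UNIV)"
    proof
      fix p assume p: "p \<in> P (Suc n)"
      then have fin: "finite (dom p)" and sub: "dom p \<subseteq> I" and c: "card (dom p) = Suc n"
        by (auto simp: P_def cohen_poset_def)
      then obtain x where "x \<in> dom p" by fastforce
      then obtain b where x: "p x = Some b" by blast
      have "card (dom p - {x}) = n" using c fin \<open>x \<in> dom p\<close> by (simp add: card_Diff_singleton)
      then have "p(x := None) \<in> P n" using fin sub by (auto simp: P_def cohen_poset_def)
      moreover have "p = (p(x := None))(x \<mapsto> b)" using x by (simp add: fun_upd_idem)
      ultimately show "p \<in> (\<lambda>(p, x, b). p(x \<mapsto> b)) ` (P n \<times> I \<times> UNIV)"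
        using \<open>x \<in> dom p\<close> sub by (intro image_eqI[where x = "(p(x := None), x, b)"]) auto
    qed
    from ordLeq_transitive[OF card_of_mono1[OF this] card_of_image]
    have "|P (Suc n)| \<le>o |P n \<times> I \<times> (UNIV :: bool set)|" .
    also have "|P n \<times> I \<times> (UNIV :: bool set)| \<le>o |I|"
      by (intro times F Suc bool ordIso_imp_ordLeq[OF card_of_refl])
    finally show ?case .
  qed
  moreover have "|UNIV :: nat set| \<le>o |I|" using I infinite_iff_card_of_nat by blast
  ultimately have "|\<Union>n. P n| \<le>o |I|"
    by (intro card_of_UNION_ordLeq_infinite[OF I]) auto
  moreover have "cohen_poset I = (\<Union>n. P n)" by (auto simp: P_def)
  ultimately show ?thesis by simp
qed

lemma infinite_card_aleph2:
  assumes "|A| =o aleph2"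
  shows "infinite A"
proof -
  have "|A| =o |Field aleph2|"
    using ordIso_transitive[OF assms ordIso_symmetric[OF card_of_Field_ordIso[OF Card_order_aleph2]]] .
  then show ?thesis using card_of_ordIso_finite infinite_aleph2 by blast
qed

lemma card_coord:
  assumes "|UNIV :: 'i set| =o aleph2"
  shows "|UNIV :: ('i \<times> bool) coord set| =o aleph2"
proof -
  have inf: "infinite (UNIV :: 'i set)" using infinite_card_aleph2[OF assms] .
  let ?r = "|UNIV :: 'i set|"
  note times = card_of_Times_ordLeq_infinite_Field[of ?r, OF _ _ _ card_of_Card_order]
  have F: "infinite (Field ?r)" using inf by (simp add: Field_card_of)
  have nat: "|UNIV :: nat set| \<le>o ?r" using inf infinite_iff_card_of_nat by blast
  have bool: "|UNIV :: bool set| \<le>o ?r" using inf by (simp add: finite_ordLeq_infinite)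
  have "|UNIV \<times> UNIV :: ('i \<times> bool) set| \<le>o ?r"
    by (intro times F bool ordIso_imp_ordLeq[OF card_of_refl])
  then have "|UNIV \<times> UNIV :: (('i \<times> bool) \<times> nat) set| \<le>o ?r"
    by (intro times F nat) simp
  then have ibn: "|UNIV :: (('i \<times> bool) \<times> nat) set| \<le>o ?r" by simp
  have "c \<in> range Z \<union> (range (\<lambda>(j, k). C j k) \<union> range (\<lambda>(j, k). D j k))"
    for c :: "('i \<times> bool) coord" by (cases c) (auto simp: image_iff)
  then have "(UNIV :: ('i \<times> bool) coord set) = range Z \<union> (range (\<lambda>(j, k). C j k) \<union> range (\<lambda>(j, k). D j k))"
    by blast
  moreover have "|range Z \<union> (range (\<lambda>(j, k). C j k) \<union> range (\<lambda>(j, k). D j k)) :: ('i \<times> bool) coord set| \<le>o ?r"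
    by (intro card_of_Un_ordLeq_infinite_Field[OF F _ _ card_of_Card_order]
        ordLeq_transitive[OF card_of_image nat] ordLeq_transitive[OF card_of_image ibn])
  ultimately have le: "|UNIV :: ('i \<times> bool) coord set| \<le>o ?r" by simp
  have "inj (\<lambda>i :: 'i. C (i, True) 0)" by (auto simp: inj_on_def)
  then have "?r \<le>o |UNIV :: ('i \<times> bool) coord set|"
    by (rule card_of_ordLeqI) simp
  with le have "|UNIV :: ('i \<times> bool) coord set| =o ?r" by (simp add: ordIso_iff_ordLeq)
  then show ?thesis using assms by (rule ordIso_transitive)
qed

section \<open>The counterexample\<close>

text \<open>An index carries its kind in the second component, so there are aleph-two reals of
  either kind.\<close>

locale hidden_real_aleph2 = hidden_real co snd for co :: "('i \<times> bool) coord \<Rightarrow> 'a" +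
  assumes card_index: "|UNIV :: 'i set| =o aleph2"
begin

lemma card_range_co: "|range co| =o aleph2"
proof -
  have "|UNIV :: ('i \<times> bool) coord set| =o |range co|"
    by (rule card_of_ordIsoI[OF inj_on_imp_bij_betw[OF inj_co]])
  from ordIso_transitive[OF ordIso_symmetric[OF this] card_coord[OF card_index]]
  show ?thesis .
qed

text \<open>Choose one condition from each member of \<open>E\<close>. If \<open>E\<close> had at
  most aleph-one members, these conditions would all miss the coordinate
  \<open>C (i, True) 0\<close> for some \<open>i\<close>. None of them could then put 0 into that
  real, although some nonzero part of \<open>b\<close> does.\<close>

lemma dense_below_large:
  assumes b: "b \<in> inv_alg" "b \<noteq> {}" and E: "dense_below inv_alg b E"
  shows "aleph2 \<le>o |E|"
proof (rule ccontr)
  assume "\<not> aleph2 \<le>o |E|"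
  then have E1: "|E| \<le>o cardSuc natLeq" by (simp add: less_aleph2)
  obtain p where p: "p \<in> b" using b by blast
  define s where "s d = (SOME q. q \<in> d)" for d :: "('a \<rightharpoonup> bool) set"
  have s: "s d \<in> d" if "d \<in> E" for d
  proof -
    have "d \<noteq> {}" using that E unfolding dense_below_def by blast
    then show ?thesis unfolding s_def by (simp add: some_in_eq)
  qed
  have C: "U \<subseteq> cohen_poset (range co)" if "U \<in> inv_alg" for U
    using that inv_alg_regular_open regular_openD by blast
  have sC: "s d \<in> cohen_poset (range co)" if "d \<in> E" for d
    using s[OF that] C that E unfolding dense_below_def by blast
  define Y where "Y = (\<Union>d\<in>E. {i. co (C (i, True) 0) \<in> dom (s d) \<union> dom p})"
  have "|Y| \<le>o cardSuc natLeq"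
    unfolding Y_def
  proof (rule UN_aleph1[OF E1])
    fix d assume "d \<in> E"
    then have "finite (dom (s d) \<union> dom p)" using sC C[OF b(1)] p by (auto simp: cohen_poset_def)
    moreover have "inj (\<lambda>i. co (C (i, True) 0))" by (auto simp: inj_on_def)
    ultimately show "countable {i. co (C (i, True) 0) \<in> dom (s d) \<union> dom p}"
      using finite_vimageI[of "dom (s d) \<union> dom p" "\<lambda>i. co (C (i, True) 0)"]
      by (auto simp: vimage_def intro: countable_finite)
  qed
  moreover have "aleph2 \<le>o |UNIV :: 'i set|"
    by (rule ordIso_imp_ordLeq[OF ordIso_symmetric[OF card_index]])
  ultimately have "Y \<noteq> UNIV" using less_aleph2 by metis
  then obtain i where i: "i \<notin> Y" by blast
  \<comment> \<open>The domain of \<open>p\<close> enters \<open>Y\<close> only through the members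
    of \<open>E\<close>, so nonemptiness of \<open>E\<close> is what makes \<open>i\<close> avoid
    it.\<close>
  have "E \<noteq> {}" using E b unfolding dense_below_def by blast
  then have "co (C (i, True) 0) \<notin> dom p" using i unfolding Y_def by blast
  then obtain q where q: "q \<in> elem (i, True) 0" "p \<subseteq>\<^sub>m q"
    using elem_extend(2) p C[OF b(1)] by blast
  then have "q \<in> b"
    using regular_open_up[OF inv_alg_regular_open[OF b(1)] p] C[OF elem_inv_alg] by blast
  then have "b \<inter> elem (i, True) 0 \<noteq> {}" using q by blast
  have "\<exists>d\<in>E. d \<subseteq> c" if "c \<in> inv_alg" "c \<noteq> {}" "c \<subseteq> b" for c
    using that E unfolding dense_below_def by simp
  from this[OF inv_alg_Int[OF b(1) elem_inv_alg] \<open>b \<inter> elem (i, True) 0 \<noteq> {}\<close> inf_le1]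
  obtain d where d: "d \<in> E" "d \<subseteq> b \<inter> elem (i, True) 0" by blast
  have "co (C (i, True) 0) \<notin> dom (s d)" using i d(1) unfolding Y_def by blast
  then have "s d \<notin> elem (i, True) 0" using elem_extend(1) sC[OF d(1)] by blast
  then show False using s[OF d(1)] d(2) by blast
qed

lemma inv_alg_uniform_density: "uniform_density inv_alg aleph2"
  unfolding uniform_density_def
proof (intro ballI impI conjI allI)
  fix b assume b: "b \<in> inv_alg" "b \<noteq> {}"
  let ?E = "(\<lambda>p. \<Inter>{U \<in> inv_alg. p \<in> U}) ` b"
  have E: "dense_below inv_alg b ?E" using inv_alg_dense_below[OF b(1)] .
  have inf: "infinite (range co)" using infinite_card_aleph2[OF card_range_co] .
  have "|b| \<le>o |cohen_poset (range co)|"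
    using b inv_alg_regular_open regular_openD by (intro card_of_mono1) blast
  also have "|cohen_poset (range co)| \<le>o |range co|" by (rule card_cohen_poset[OF inf])
  also have "|range co| =o aleph2" by (rule card_range_co)
  finally have "|?E| \<le>o aleph2" by (rule ordLeq_transitive[OF card_of_image])
  then have "|?E| =o aleph2" using dense_below_large[OF b E] by (simp add: ordIso_iff_ordLeq)
  then show "\<exists>E. dense_below inv_alg b E \<and> |E| =o aleph2" using E by blast
qed (rule dense_below_large)

text \<open>An isomorphism \<open>f\<close> with inverse \<open>g\<close> is refuted at a free pair
  \<open>a\<close>, \<open>b\<close>: for a nonzero \<open>c\<close> forcing these two reals to be
  disjoint, \<open>f c\<close> turns out to meet the intersection of \<open>f (elem a k)\<close> and
  \<open>f (elem b k)\<close> for some \<open>k\<close>.\<close>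

lemma inv_alg_not_cohen: "\<not> ba_isomorphic inv_alg (cohen_algebra (range co))"
proof
  let ?I = "range co"
  assume "ba_isomorphic inv_alg (cohen_algebra ?I)"
  then obtain f where bij: "bij_betw f inv_alg (cohen_algebra ?I)"
    and f_mono: "\<forall>U\<in>inv_alg. \<forall>V\<in>inv_alg. U \<subseteq> V \<longleftrightarrow> f U \<subseteq> f V"
    unfolding ba_isomorphic_def by auto
  have mono: "U \<subseteq> V \<longleftrightarrow> f U \<subseteq> f V" if "U \<in> inv_alg" "V \<in> inv_alg" for U V
    using f_mono that by simp
  define g where "g = inv_into inv_alg f"
  have ro: "regular_open ?I U" if "U \<in> inv_alg" for U using that inv_alg_regular_open by blast
  have f_ro: "regular_open ?I (f U)" if "U \<in> inv_alg" for U
    using that bij unfolding bij_betw_def cohen_algebra_def by blast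
  have g: "g U \<in> inv_alg" "f (g U) = U" if "regular_open ?I U" for U
    using that bij_betw_apply[OF bij_betw_inv_into[OF bij], of U] bij_betw_inv_into_right[OF bij, of U]
    unfolding g_def cohen_algebra_def by simp_all
  have g_mono: "g U \<subseteq> g V" if "regular_open ?I U" "regular_open ?I V" "U \<subseteq> V" for U V
    using that mono[OF g(1) g(1)] g(2) by simp
  have f0: "f {} = {}"
    using mono[OF inv_alg_empty g(1)[OF regular_open_empty]] g(2)[OF regular_open_empty] by simp
  have f_ne: "f U \<noteq> {}" if "U \<in> inv_alg" "U \<noteq> {}" for U
    using that mono[OF that(1) inv_alg_empty] f0 by auto
  define supp where "supp U = (SOME J. countable J \<and> J \<subseteq> ?I \<and> supported U J)" for U :: "('a \<rightharpoonup> bool) set"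
  have supp: "countable (supp U)" "supported U (supp U)" if "regular_open ?I U" for U
    using someI_ex[OF countable_support[OF that]] unfolding supp_def by simp_all
  \<comment> \<open>Countably many Cohen coordinates carry the images of all bits of the real
    \<open>j\<close>.\<close>
  define J where "J j = (\<Union>k. supp (f (elem j k)))" for j
  have J: "countable (J j)" for j
    unfolding J_def using supp(1) f_ro elem_inv_alg by (intro countable_UN) auto
  define P where "P j = cohen_poset (J j) \<inter> cohen_poset ?I" for j
  have P: "countable (P j)" for j
  proof -
    \<comment> \<open>Conditions are coded by their graphs, which are finite subsets of a countable
      set.\<close>
    have "Map.graph p \<in> Fpow (J j \<times> UNIV)" if "p \<in> P j" for p
      using that by (auto simp: P_def cohen_poset_def Fpow_def Map.graph_def
          simp flip: finite_graph_iff_finite_dom)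
    then have "Map.graph ` P j \<subseteq> Fpow (J j \<times> UNIV)" by blast
    moreover have "countable (Fpow (J j \<times> (UNIV :: bool set)))" using J by (intro countable_Fpow) simp
    ultimately have "countable (Map.graph ` P j)" by (rule countable_subset)
    moreover have "inj_on Map.graph (P j)"
      by (rule inj_onI) (auto simp: Map.graph_def set_eq_iff fun_eq_iff, metis not_Some_eq)
    ultimately show ?thesis by (rule countable_image_inj_on)
  qed
  \<comment> \<open>The reals on whose private coordinates the pull-back of some condition over
    \<open>J j\<close> may depend.\<close>
  define G where "G j = (\<Union>p\<in>P j. {i. own i \<inter> supp (g (basic_open ?I p)) \<noteq> {}})" for j
  have "countable (G j)" for j
    unfolding G_def
  proof (rule countable_UN[OF P])
    fix p assume p: "p \<in> P j"
    \<comment> \<open>Private coordinate sets are pairwise disjoint, so each coordinate of the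
      countable support accounts for at most one index.\<close>
    have "{i. own i \<inter> supp (g (basic_open ?I p)) \<noteq> {}} \<subseteq>
        (\<lambda>x. THE i. x \<in> own i) ` supp (g (basic_open ?I p))"
    proof
      fix i assume "i \<in> {i. own i \<inter> supp (g (basic_open ?I p)) \<noteq> {}}"
      then obtain x where x: "x \<in> own i" "x \<in> supp (g (basic_open ?I p))" by blast
      then have "(THE i. x \<in> own i) = i"
        by (intro the_equality) (auto simp: own_def)
      then show "i \<in> (\<lambda>x. THE i. x \<in> own i) ` supp (g (basic_open ?I p))" using x(2) by force
    qed
    moreover have "regular_open ?I (g (basic_open ?I p))"
      using p regular_open_basic_open g(1) ro unfolding P_def by blast
    ultimately show "countable {i. own i \<inter> supp (g (basic_open ?I p)) \<noteq> {}}"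
      by (rule countable_subset[OF _ countable_image[OF supp(1)]])
  qed
  moreover have "aleph2 \<le>o |UNIV :: 'i set|"
    by (rule ordIso_imp_ordLeq[OF ordIso_symmetric[OF card_index]])
  ultimately obtain a b where ab: "snd a \<noteq> snd b" "a \<notin> G b" "b \<notin> G a"
    using free_pair by blast
  obtain c where c: "c \<in> inv_alg" "c \<noteq> {}" "\<And>k. c \<inter> elem a k \<inter> elem b k = {}"
    using disjoint_promise[OF ab(1)] by blast
  obtain p where p: "p \<in> f c" using f_ne c by blast
  have pC: "p \<in> cohen_poset ?I" using p f_ro[OF c(1)] regular_openD by blast
  \<comment> \<open>The pull-back of \<open>p\<close> itself may depend on the private coordinates
    of both reals. Pulling back its parts on \<open>J a\<close> and \<open>J b\<close> separately
    gives \<open>W a\<close>, which avoids those of \<open>b\<close>, and \<open>W b\<close>, which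
    avoids those of \<open>a\<close>.\<close>
  define pp where "pp j = p |` J j" for j
  have pp: "pp j \<in> P j" "pp j \<in> cohen_poset ?I" for j
    using pC unfolding pp_def P_def cohen_poset_def by auto
  define W where "W j = g (basic_open ?I (pp j))" for j
  have basic_ro: "regular_open ?I (basic_open ?I q)" if "q \<in> cohen_poset ?I" for q
    using that by (rule regular_open_basic_open)
  have W: "W j \<in> inv_alg" "f (W j) = basic_open ?I (pp j)" for j
    unfolding W_def using g[OF basic_ro[OF pp(2)]] by auto
  have "g (basic_open ?I p) \<subseteq> W j" for j
  proof -
    have "basic_open ?I p \<subseteq> basic_open ?I (pp j)"
      using restrict_map_le[of p "J j"] map_le_trans unfolding basic_open_def pp_def by blast
    then show ?thesis unfolding W_def using g_mono basic_ro pC pp(2) by blast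
  qed
  moreover have "g (basic_open ?I p) \<noteq> {}"
    using g(2)[OF basic_ro[OF pC]] f0 pC map_le_refl unfolding basic_open_def by force
  ultimately have ne: "W a \<inter> W b \<noteq> {}" by blast
  have W_own: "q |` (- own i) \<in> W j" if i: "i \<notin> G j" and q: "q \<in> W j" for i j q
  proof -
    let ?S = "supp (W j)"
    have roW: "regular_open ?I (W j)" using ro W by blast
    have "own i \<inter> ?S = {}" using i pp(1) unfolding G_def W_def by blast
    then have "q |` ?S \<subseteq>\<^sub>m q |` (- own i)" by (auto simp: map_le_def restrict_map_def)
    moreover have "q |` ?S \<in> W j" using supp(2)[OF roW] q unfolding supported_def by blast
    moreover have "q |` (- own i) \<in> cohen_poset ?I"
      using q regular_openD[OF roW] cohen_poset_restrict by blast
    ultimately show ?thesis using regular_open_up[OF roW] by blast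
  qed
  have "a \<noteq> b" using ab(1) by blast
  from overlap[OF W(1) W(1) ne this W_own[OF ab(3)] W_own[OF ab(2)]]
  obtain k where k: "W a \<inter> W b \<inter> elem a k \<inter> elem b k \<noteq> {}" by blast
  define V where "V = W a \<inter> W b \<inter> elem a k \<inter> elem b k"
  have V: "V \<in> inv_alg" unfolding V_def by (intro inv_alg_Int W(1) elem_inv_alg)
  have sub: "V \<subseteq> W a" "V \<subseteq> W b" "V \<subseteq> elem a k" "V \<subseteq> elem b k" by (auto simp: V_def)
  have "f V \<subseteq> f (W a)" "f V \<subseteq> f (W b)" "f V \<subseteq> f (elem a k)" "f V \<subseteq> f (elem b k)"
    using mono[OF V W(1)] mono[OF V elem_inv_alg] sub by simp_all
  moreover obtain q where "q \<in> f V" using f_ne[OF V] k unfolding V_def by blast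
  ultimately have q: "q \<in> cohen_poset ?I" "pp a \<subseteq>\<^sub>m q" "pp b \<subseteq>\<^sub>m q" "q \<in> f (elem a k)" "q \<in> f (elem b k)"
    using W(2) unfolding basic_open_def by auto
  \<comment> \<open>\<open>s\<close> extends \<open>p\<close>, hence stays in \<open>f c\<close>,
    and adds the part of \<open>q\<close> that places \<open>q\<close> in the images of the two
    bits. Both parts agree where they meet, because \<open>q\<close> extends the restrictions of
    \<open>p\<close> to \<open>J a\<close> and \<open>J b\<close>.\<close>
  define s where "s = p ++ q |` (J a \<union> J b)"
  have sC: "s \<in> cohen_poset ?I" unfolding s_def using pC q(1) cohen_poset_add cohen_poset_restrict by blast
  have "p \<subseteq>\<^sub>m s"
    unfolding s_def
  proof (rule map_le_addI)
    fix x u v assume x: "p x = Some u" "(q |` (J a \<union> J b)) x = Some v"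
    then have "x \<in> J a \<or> x \<in> J b" "q x = Some v" by (auto simp: restrict_map_def split: if_splits)
    moreover have "q x = Some u" if "x \<in> J a \<or> x \<in> J b"
      using that x(1) q(2,3) unfolding pp_def map_le_def
      by (auto simp: restrict_map_def dom_def split: if_splits)
    ultimately show "u = v" by simp
  qed
  then have sc: "s \<in> f c" using regular_open_up[OF f_ro[OF c(1)] p _ sC] by blast
  have sel: "s \<in> f (elem j k)" if j: "j \<in> {a, b}" "q \<in> f (elem j k)" for j
  proof -
    have r: "regular_open ?I (f (elem j k))" using f_ro elem_inv_alg by blast
    have "q |` supp (f (elem j k)) \<in> f (elem j k)"
      using supp(2)[OF r] j(2) unfolding supported_def by blast
    moreover have "q |` supp (f (elem j k)) \<subseteq>\<^sub>m q |` (J a \<union> J b)"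
      using j(1) by (auto simp: map_le_def restrict_map_def J_def)
    then have "q |` supp (f (elem j k)) \<subseteq>\<^sub>m s"
      unfolding s_def using map_le_trans map_le_map_add by blast
    ultimately show ?thesis using regular_open_up[OF r] sC by blast
  qed
  define O' where "O' = f c \<inter> f (elem a k) \<inter> f (elem b k)"
  have O': "regular_open ?I O'" unfolding O'_def by (intro regular_open_Int f_ro c(1) elem_inv_alg)
  have "s \<in> O'" using sc sel q(4,5) unfolding O'_def by blast
  then have "g O' \<noteq> {}" using g(2)[OF O'] f0 by auto
  moreover have "g O' \<subseteq> c" "g O' \<subseteq> elem a k" "g O' \<subseteq> elem b k"
    using mono[OF g(1)[OF O'] c(1)] mono[OF g(1)[OF O'] elem_inv_alg] g(2)[OF O']
    by (auto simp: O'_def)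
  ultimately show False using c(3)[of k] by blast
qed

end

text \<open>The datatype of coordinates takes its indices from a type, so a type with aleph-two
  elements is introduced.\<close>

typedef omega2 = "Field aleph2"
  using infinite_imp_nonempty[OF infinite_aleph2] by blast

lemma card_omega2: "|UNIV :: omega2 set| =o aleph2"
proof -
  have "bij_betw Rep_omega2 UNIV (Field aleph2)"
    by (metis bij_betw_def inj_on_def Rep_omega2_inject type_definition.Rep_range type_definition_omega2)
  from ordIso_transitive[OF card_of_ordIsoI[OF this] card_of_Field_ordIso[OF Card_order_aleph2]]
  show ?thesis .
qed

theorem theorem2:
  fixes I :: "'a set"
  assumes "ordIso2 (card_of I) aleph2"
  shows "\<exists>A. complete_subalgebra I A \<and> uniform_density A aleph2 \<and>
           \<not> ba_isomorphic A (cohen_algebra I)"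
proof -
  \<comment> \<open>The coordinates are as many as the elements of \<open>I\<close>, so
    \<open>co\<close> can be chosen with range exactly \<open>I\<close>.\<close>
  have "|UNIV :: (omega2 \<times> bool) coord set| =o |I|"
    using card_coord[OF card_omega2] assms ordIso_symmetric ordIso_transitive by blast
  then obtain co :: "(omega2 \<times> bool) coord \<Rightarrow> 'a" where co: "bij_betw co UNIV I"
    using card_of_ordIso by blast
  then interpret hidden_real_aleph2 co
    by unfold_locales (auto simp: bij_betw_def card_omega2)
  have "range co = I" using co by (simp add: bij_betw_def)
  then show ?thesis
    using inv_alg_complete_subalgebra inv_alg_uniform_density inv_alg_not_cohen by blast
qed

end
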